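(* Let $q=p^m$ be an odd prime power, $p$ an odd prime, and let $\{A_{\alpha,0},A_{\alpha,1},A_2\mid\alpha\in\mathbb{F}_q\}$ be the association scheme defined in the context. Put $F_{\alpha,i}=\sum_{\gamma\in\mathbb{F}_q}\chi_\alpha(\gamma)A_{\gamma,i}$ for $\alpha\in\mathbb{F}_q$, $i\in\{0,1\}$, and for $\alpha\in\mathbb{F}_q^*$ define $$E_0=\tfrac1{(q+1)q^2}J_{(q+1)q^2},\quad E_1=\tfrac1{(q+1)q^2}\big((q^2-1)F_{0,0}-(q+1)A_2\big),\quad E_2=\tfrac1{(q+1)q^2}\big(qF_{0,0}-F_{0,1}+qA_2\big),$$ $$E_{1,1}^{(\alpha)}=\tfrac1qF_{\alpha,0},\quad E_{2,2}^{(\alpha)}=\tfrac1qF_{-\alpha,0},\quad E_{1,2}^{(\alpha)}=\tfrac1{q^2}F_{\alpha,1},\quad E_{2,1}^{(\alpha)}=\tfrac1{q^2}F_{-\alpha,1}.$$ Let $S$ be any subset of $\mathbb{F}_q^*$ such that $S\cup(-S)=\mathbb{F}_q^*$ and $S\cap(-S)=\emptyset$. Then the matrices $E_0,E_1,E_2,E_{1,1}^{(\alpha)},E_{1,2}^{(\alpha)},E_{2,1}^{(\alpha)},E_{2,2}^{(\alpha)}$, $\alpha\in S$, provide the Wedderburn decomposition of the adjacency algebra of the association scheme.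
   Context: $I_r$, $J_r$: identity and all-ones matrices of order $r$. The adjacency algebra of an association scheme is the complex span of its adjacency matrices. A family of matrices $E_i$ (one-dimensional components) and $E_{j,k}^{(\alpha)}$, $j,k\in\{1,2\}$ (two-dimensional components), provides the Wedderburn decomposition of the adjacency algebra $\mathcal{A}$ if it is a basis of $\mathcal{A}$ satisfying $E_iE_{i'}=\delta_{i,i'}E_i$, $E_iE_{j,k}^{(\alpha)}=E_{j,k}^{(\alpha)}E_i=0$, $E_{j,k}^{(\alpha)}E_{j',k'}^{(\beta)}=\delta_{\alpha,\beta}\delta_{k,j'}E_{j,k'}^{(\alpha)}$, and $E_i^*=E_i$, $(E_{j,k}^{(\alpha)})^*=E_{k,j}^{(\alpha)}$ ($*$ = conjugate transpose). Identify the additive group of $\mathbb{F}_q$ with $\mathbb{Z}_p^m$, its elements being ordered lexicographically (coordinates in $0<1<\dots<p-1$). Let $U$ be the $p\times p$ circulant matrix with first row $(0,1,0,\dots,0)$, and $\phi((x_i)_{i=1}^m)=\bigotimes_{i=1}^mU^{x_i}$. For $\alpha,\alpha'\in\mathbb{F}_q$ let $C_{\alpha,\alpha'}=(\phi(\alpha(-\beta+\beta')+\alpha'))_{\beta,\beta'\in\mathbb{F}_q}$, a $q^2\times q^2$ $(0,1)$-matrix made of $q\times q$ blocks. Let $x$ be an indeterminate and $L$ a symmetric Latin square of order $q+1$ on the symbol set $\mathbb{F}_q\cup\{x\}$ with constant diagonal $x$; $P_a$ is the symmetric permutation matrix of order $q+1$ marking the positions of the symbol $a$ in $L$ (so $P_x=I_{q+1}$).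 Let $R$ be the back identity matrix of order $q^2$ (ones on the anti-diagonal). For $\alpha\in\mathbb{F}_q$ let $N_\alpha=I_{q+1}\otimes(J_{q^2}-I_q\otimes J_q)+\sum_{a\in\mathbb{F}_q}P_a\otimes C_{a,\alpha}R$. Define $A_{\alpha,0}=I_{q(q+1)}\otimes\phi(\alpha)$, $A_{\alpha,1}=N_\alpha-I_{q+1}\otimes(J_{q^2}-I_q\otimes J_q)$, $A_2=I_{q+1}\otimes(J_{q^2}-I_q\otimes J_q)$. Characters: $\chi_\beta(\alpha)=w^{\langle\alpha,\beta\rangle}$ for $\alpha,\beta\in\mathbb{Z}_p^m$, where $\langle\alpha,\beta\rangle=\alpha_1\beta_1+\dots+\alpha_m\beta_m$ and $w=e^{2\pi\sqrt{-1}/p}$. *)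

theory Defs
  imports
    "HOL-Library.Cardinality"
    "HOL-Computational_Algebra.Primes"
    "Jordan_Normal_Form.VS_Connect"
    "Jordan_Normal_Form.Schur_Decomposition"
begin

section \<open>Matrices\<close>

definition all_ones_mat :: "nat \<Rightarrow> complex mat"
  where "all_ones_mat n = mat n n (\<lambda>_. 1)"

definition back_identity_mat :: "nat \<Rightarrow> complex mat"
  where "back_identity_mat n = mat n n (\<lambda>(i, j). if i + j + 1 = n then 1 else 0)"

definition kronecker_mat :: "complex mat \<Rightarrow> complex mat \<Rightarrow> complex mat" (infixr \<open>\<otimes>\<^sub>m\<close> 72)
  where "A \<otimes>\<^sub>m B = mat (dim_row A * dim_row B) (dim_col A * dim_col B)
    (\<lambda>(i, j). A $$ (i div dim_row B, j div dim_col B) * B $$ (i mod dim_row B, j mod dim_col B))"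

abbreviation mat_space :: "nat \<Rightarrow> (complex, complex mat) module"
  where "mat_space n \<equiv> module_mat TYPE(complex) n n"

abbreviation matsum :: "nat \<Rightarrow> ('i \<Rightarrow> complex mat) \<Rightarrow> 'i set \<Rightarrow> complex mat"
  where "matsum n f X \<equiv> finsum (mat_space n) f X"


section \<open>Adjacency algebra and Wedderburn decomposition\<close>

definition adjacency_algebra :: "nat \<Rightarrow> complex mat set \<Rightarrow> complex mat set"
  where "adjacency_algebra n \<A> = LinearCombinations.module.span class_ring (mat_space n) \<A>"

text \<open>The one-dimensional components are \<open>E i\<close> for \<open>i \<in> I\<close>, the two-dimensional ones
  \<open>F \<alpha> j k\<close> for \<open>\<alpha> \<in> T\<close> and \<open>j, k \<in> {1, 2}\<close>. The basis is meant as an indexed family, hence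
  the injectivity requirement next to \<open>vectorspace.basis\<close>, which speaks about sets.\<close>

definition wedderburn_decomposition ::
  "nat \<Rightarrow> complex mat set \<Rightarrow> 'i set \<Rightarrow> ('i \<Rightarrow> complex mat) \<Rightarrow>
   'j set \<Rightarrow> ('j \<Rightarrow> nat \<Rightarrow> nat \<Rightarrow> complex mat) \<Rightarrow> bool"
  where "wedderburn_decomposition n B I E T F \<longleftrightarrow>
    (let G = case_sum E (\<lambda>(\<alpha>, j, k). F \<alpha> j k);
         K = Inl ` I \<union> Inr ` (T \<times> {1, 2} \<times> {1, 2})
     in inj_on G K \<and>
        vectorspace.basis class_ring (vectorspace.vs (mat_space n) B) (G ` K)) \<and>
    (\<forall>i\<in>I. \<forall>i'\<in>I. E i * E i' = (if i = i' then E i else 0\<^sub>m n n)) \<and>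
    (\<forall>i\<in>I. \<forall>\<alpha>\<in>T. \<forall>j\<in>{1, 2}. \<forall>k\<in>{1, 2}.
        E i * F \<alpha> j k = 0\<^sub>m n n \<and> F \<alpha> j k * E i = 0\<^sub>m n n) \<and>
    (\<forall>\<alpha>\<in>T. \<forall>\<beta>\<in>T. \<forall>j\<in>{1, 2}. \<forall>k\<in>{1, 2}. \<forall>j'\<in>{1, 2}. \<forall>k'\<in>{1, 2}.
        F \<alpha> j k * F \<beta> j' k' = (if \<alpha> = \<beta> \<and> k = j' then F \<alpha> j k' else 0\<^sub>m n n)) \<and>
    (\<forall>i\<in>I. mat_adjoint (E i) = E i) \<and>
    (\<forall>\<alpha>\<in>T. \<forall>j\<in>{1, 2}. \<forall>k\<in>{1, 2}. mat_adjoint (F \<alpha> j k) = F \<alpha> k j)"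


section \<open>The additive group of the field as \<open>\<int>\<^sub>p\<^sup>m\<close>\<close>

text \<open>Elements of \<open>\<int>\<^sub>p\<^sup>m\<close> are lists of length \<open>m\<close> with entries in \<open>{0, \<dots>, p - 1}\<close>. The finite field
  is the type \<open>'a\<close>, and \<open>c\<close> is the identification of its additive group with \<open>\<int>\<^sub>p\<^sup>m\<close>.\<close>

definition additive_identification :: "nat \<Rightarrow> nat \<Rightarrow> ('a::{field,finite} \<Rightarrow> nat list) \<Rightarrow> bool"
  where "additive_identification p m c \<longleftrightarrow>
    bij_betw c UNIV {xs. length xs = m \<and> set xs \<subseteq> {..<p}} \<and>
    (\<forall>x y. c (x + y) = map2 (\<lambda>a b. (a + b) mod p) (c x) (c y))"

definition Zp_lex_list :: "nat \<Rightarrow> nat \<Rightarrow> nat list list"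
  where "Zp_lex_list p m = product_lists (replicate m [0..<p])"

lemma set_Zp_lex_list: "set (Zp_lex_list p m) = {xs. length xs = m \<and> set xs \<subseteq> {..<p}}"
proof -
  have "set (product_lists (replicate m [0..<p])) = {xs. list_all2 (\<lambda>x ys. x \<in> set ys) xs (replicate m [0..<p])}"
    by (rule product_lists_set)
  also have "\<dots> = {xs. length xs = m \<and> (\<forall>i<length xs. xs ! i < p)}"
    unfolding list_all2_conv_all_nth by auto
  also have "\<dots> = {xs. length xs = m \<and> set xs \<subseteq> {..<p}}"
    unfolding subset_eq all_set_conv_all_nth by simp
  finally show ?thesis by (simp add: Zp_lex_list_def)
qed

lemma sorted_Zp_lex_list: "sorted_wrt (\<lambda>xs ys. (xs, ys) \<in> lexord less_than) (Zp_lex_list p m)"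
proof (induction m)
  case 0
  show ?case by (simp add: Zp_lex_list_def)
next
  case (Suc m)
  let ?Q = "\<lambda>xs ys. (xs, ys) \<in> lexord less_than"
  let ?l = "product_lists (replicate m [0..<p])"
  have "sorted_wrt ?Q (concat (map (\<lambda>x. map ((#) x) ?l) zs))" if "sorted_wrt (<) zs" for zs
    using that Suc.IH[unfolded Zp_lex_list_def]
    by (induction zs) (auto simp: sorted_wrt_append sorted_wrt_map)
  then show ?case by (simp add: Zp_lex_list_def)
qed

definition nth_elem :: "nat \<Rightarrow> nat \<Rightarrow> ('a::{field,finite} \<Rightarrow> nat list) \<Rightarrow> nat \<Rightarrow> 'a"
  where "nth_elem p m c i = inv_into UNIV c (Zp_lex_list p m ! i)"

definition character :: "nat \<Rightarrow> ('a::{field,finite} \<Rightarrow> nat list) \<Rightarrow> 'a \<Rightarrow> 'a \<Rightarrow> complex"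
  where "character p c \<beta> \<alpha> =
    exp (2 * of_real pi * \<i> / of_nat p) ^ sum_list (map2 (*) (c \<alpha>) (c \<beta>))"


section \<open>The association scheme\<close>

definition shift_mat :: "nat \<Rightarrow> complex mat"
  where "shift_mat p = mat p p (\<lambda>(i, j). if j = (i + 1) mod p then 1 else 0)"

definition phi_list :: "nat \<Rightarrow> nat list \<Rightarrow> complex mat"
  where "phi_list p xs = foldr (\<lambda>x M. (shift_mat p ^\<^sub>m x) \<otimes>\<^sub>m M) xs (1\<^sub>m 1)"

definition phi :: "nat \<Rightarrow> ('a::{field,finite} \<Rightarrow> nat list) \<Rightarrow> 'a \<Rightarrow> complex mat"
  where "phi p c \<alpha> = phi_list p (c \<alpha>)"

definition C_mat :: "nat \<Rightarrow> nat \<Rightarrow> ('a::{field,finite} \<Rightarrow> nat list) \<Rightarrow> 'a \<Rightarrow> 'a \<Rightarrow> complex mat"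
  where "C_mat p m c \<alpha> \<alpha>' = (let q = CARD('a) in
    mat (q^2) (q^2) (\<lambda>(i, j).
      phi p c (\<alpha> * (- nth_elem p m c (i div q) + nth_elem p m c (j div q)) + \<alpha>') $$ (i mod q, j mod q)))"

definition latin_square :: "nat \<Rightarrow> 's set \<Rightarrow> 's mat \<Rightarrow> bool"
  where "latin_square n X L \<longleftrightarrow> L \<in> carrier_mat n n \<and>
    (\<forall>i<n. bij_betw (\<lambda>j. L $$ (i, j)) {..<n} X) \<and>
    (\<forall>j<n. bij_betw (\<lambda>i. L $$ (i, j)) {..<n} X)"

text \<open>The symbol set \<open>\<bbbF>\<^sub>q \<union> {x}\<close> is \<open>'a option\<close>, with \<open>None\<close> for the indeterminate \<open>x\<close>.\<close>

definition symmetric_latin_square :: "'a::{field,finite} option mat \<Rightarrow> bool"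
  where "symmetric_latin_square L \<longleftrightarrow>
    latin_square (CARD('a) + 1) UNIV L \<and> transpose_mat L = L \<and>
    (\<forall>i < CARD('a) + 1. L $$ (i, i) = None)"

definition P_mat :: "'s mat \<Rightarrow> 's \<Rightarrow> complex mat"
  where "P_mat L a = mat (dim_row L) (dim_col L) (\<lambda>ij. if L $$ ij = a then 1 else 0)"

definition A2 :: "nat \<Rightarrow> complex mat"
  where "A2 q = 1\<^sub>m (q + 1) \<otimes>\<^sub>m (all_ones_mat (q^2) - 1\<^sub>m q \<otimes>\<^sub>m all_ones_mat q)"

definition N_mat :: "nat \<Rightarrow> nat \<Rightarrow> ('a::{field,finite} \<Rightarrow> nat list) \<Rightarrow> 'a option mat \<Rightarrow> 'a \<Rightarrow> complex mat"
  where "N_mat p m c L \<alpha> = (let q = CARD('a) in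
    1\<^sub>m (q + 1) \<otimes>\<^sub>m (all_ones_mat (q^2) - 1\<^sub>m q \<otimes>\<^sub>m all_ones_mat q) +
    matsum ((q + 1) * q^2)
      (\<lambda>a. P_mat L (Some a) \<otimes>\<^sub>m (C_mat p m c a \<alpha> * back_identity_mat (q^2))) UNIV)"

definition A0 :: "nat \<Rightarrow> ('a::{field,finite} \<Rightarrow> nat list) \<Rightarrow> 'a \<Rightarrow> complex mat"
  where "A0 p c \<alpha> = (let q = CARD('a) in 1\<^sub>m (q * (q + 1)) \<otimes>\<^sub>m phi p c \<alpha>)"

definition A1 :: "nat \<Rightarrow> nat \<Rightarrow> ('a::{field,finite} \<Rightarrow> nat list) \<Rightarrow> 'a option mat \<Rightarrow> 'a \<Rightarrow> complex mat"
  where "A1 p m c L \<alpha> = (let q = CARD('a) in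
    N_mat p m c L \<alpha> - 1\<^sub>m (q + 1) \<otimes>\<^sub>m (all_ones_mat (q^2) - 1\<^sub>m q \<otimes>\<^sub>m all_ones_mat q))"

definition scheme_matrices ::
  "nat \<Rightarrow> nat \<Rightarrow> ('a::{field,finite} \<Rightarrow> nat list) \<Rightarrow> 'a option mat \<Rightarrow> complex mat set"
  where "scheme_matrices p m c L = range (A0 p c) \<union> range (A1 p m c L) \<union> {A2 CARD('a)}"


section \<open>The matrix units\<close>

definition character_sum ::
  "nat \<Rightarrow> ('a::{field,finite} \<Rightarrow> nat list) \<Rightarrow> ('a \<Rightarrow> complex mat) \<Rightarrow> 'a \<Rightarrow> complex mat"
  where "character_sum p c A \<alpha> =
    matsum ((CARD('a) + 1) * CARD('a)^2) (\<lambda>\<gamma>. character p c \<alpha> \<gamma> \<cdot>\<^sub>m A \<gamma>) UNIV"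

definition F0 :: "nat \<Rightarrow> ('a::{field,finite} \<Rightarrow> nat list) \<Rightarrow> 'a \<Rightarrow> complex mat"
  where "F0 p c = character_sum p c (A0 p c)"

definition F1 :: "nat \<Rightarrow> nat \<Rightarrow> ('a::{field,finite} \<Rightarrow> nat list) \<Rightarrow> 'a option mat \<Rightarrow> 'a \<Rightarrow> complex mat"
  where "F1 p m c L = character_sum p c (A1 p m c L)"

text \<open>Only the indices \<open>0, 1, 2\<close> of \<open>E_one\<close> and the indices \<open>1, 2\<close> of \<open>E_two\<close> are meaningful.\<close>

definition E_one ::
  "nat \<Rightarrow> nat \<Rightarrow> ('a::{field,finite} \<Rightarrow> nat list) \<Rightarrow> 'a option mat \<Rightarrow> nat \<Rightarrow> complex mat"
  where "E_one p m c L i = (let q = CARD('a); r = of_nat q :: complex in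
    if i = 0 then (1 / ((r + 1) * r^2)) \<cdot>\<^sub>m all_ones_mat ((q + 1) * q^2)
    else if i = 1 then (1 / ((r + 1) * r^2)) \<cdot>\<^sub>m ((r^2 - 1) \<cdot>\<^sub>m F0 p c 0 - (r + 1) \<cdot>\<^sub>m A2 q)
    else (1 / ((r + 1) * r^2)) \<cdot>\<^sub>m (r \<cdot>\<^sub>m F0 p c 0 - F1 p m c L 0 + r \<cdot>\<^sub>m A2 q))"

definition E_two ::
  "nat \<Rightarrow> nat \<Rightarrow> ('a::{field,finite} \<Rightarrow> nat list) \<Rightarrow> 'a option mat \<Rightarrow> 'a \<Rightarrow> nat \<Rightarrow> nat \<Rightarrow> complex mat"
  where "E_two p m c L \<alpha> j k = (let r = of_nat CARD('a) :: complex in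
    if (j, k) = (1, 1) then (1 / r) \<cdot>\<^sub>m F0 p c \<alpha>
    else if (j, k) = (2, 2) then (1 / r) \<cdot>\<^sub>m F0 p c (- \<alpha>)
    else if (j, k) = (1, 2) then (1 / r^2) \<cdot>\<^sub>m F1 p m c L \<alpha>
    else (1 / r^2) \<cdot>\<^sub>m F1 p m c L (- \<alpha>))"

end

theory Submission
  imports Defs
begin

text \<open>The idea is to replace index arithmetic and Kronecker products by kernels. A row index is a triple
  \<open>(b, B, Y)\<close>: a block \<open>b \<le> q\<close> and two field elements. The lexicographic enumeration of the field
  is reversed by a point reflection \<open>x \<mapsto> 2h - x\<close>, which exists because \<open>p\<close> is odd. If \<open>B\<close> and \<open>Y\<close> are
  measured from \<open>h\<close>, the back identity matrix negates both, and the character sums become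
  \<open>F\<^bsub>\<alpha>,0\<^esub> = [b = b', B = B'] \<chi>\<^sub>\<alpha>(Y' - Y)\<close> and \<open>F\<^bsub>\<alpha>,1\<^esub> = [b \<noteq> b'] \<chi>\<^sub>\<alpha>(\<ell> (B + B') - Y - Y')\<close>,
  where \<open>\<ell>\<close> is the symbol of the Latin square at \<open>(b, b')\<close>. These are \<open>F0_eq_kernel_mat\<close> and
  \<open>F1_eq_kernel_mat\<close>.

  All products now follow from orthogonality of characters. The products that involve some
  \<open>F\<^bsub>\<alpha>,0\<^esub>\<close> reduce to a single sum over \<open>Y'\<close>. The essential one is \<open>F\<^bsub>\<alpha>,1\<^esub> F\<^bsub>\<beta>,1\<^esub>\<close> for \<open>\<alpha> \<noteq> 0\<close>
  (\<open>F1_mult_F1\<close>): the sum over \<open>Y'\<close> forces \<open>\<beta> = - \<alpha>\<close>, the sum over \<open>B'\<close> forces equal symbols at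
  \<open>(b, b')\<close> and \<open>(b', b'')\<close> and hence \<open>b = b''\<close>, and the sum over \<open>b'\<close> runs through every symbol once
  and forces \<open>B = B''\<close>. The outcome is \<open>q\<^sup>3 F\<^bsub>\<alpha>,0\<^esub>\<close>.

  The trivial character contributes the span of \<open>J\<close>, \<open>I \<otimes> J\<^bsub>q\<^sup>2\<^esub>\<close> and \<open>I \<otimes> J\<^bsub>q\<^esub>\<close>, a commutative
  algebra whose primitive idempotents are \<open>E\<^sub>0\<close>, \<open>E\<^sub>1\<close>, \<open>E\<^sub>2\<close>. One multiplication rule
  (\<open>coarse_mult\<close>) covers it. As \<open>F\<^bsub>0,0\<^esub> / q\<close> is its unit, it is orthogonal to all other characters.

  The family is linearly independent because multiplication by diagonal units isolates each
  member (\<open>extractors_imp_independent\<close>). It spans the adjacency algebra because \<open>S\<close>, \<open>- S\<close> and \<open>0\<close>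
  exhaust the field and Fourier inversion returns the scheme from its character sums.\<close>

section \<open>Bases of matrix algebras\<close>

interpretation mat_vs: matrix_vs n n "TYPE(complex)" for n .

lemma index_matsum:
  assumes "f \<in> X \<rightarrow> carrier_mat n n" and "i < n" and "j < n"
  shows "matsum n f X $$ (i, j) = (\<Sum>x\<in>X. f x $$ (i, j))"
  using assms
proof (induction X rule: infinite_finite_induct)
  case (insert x X)
  then have "f \<in> X \<rightarrow> carrier_mat n n" "f x \<in> carrier_mat n n" by auto
  moreover have "matsum n f X \<in> carrier_mat n n"
    by (rule mat_vs.finsum_closed[OF calculation(1)])
  ultimately show ?case
    using insert carrier_matD[of "matsum n f X" n n] by (simp add: mat_vs.finsum_insert)
qed auto

lemma matsum_carrier: "f \<in> X \<rightarrow> carrier_mat n n \<Longrightarrow> matsum n f X \<in> carrier_mat n n"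
  by (rule mat_vs.finsum_closed)

lemma mult_matsum_mult:
  assumes "f \<in> X \<rightarrow> carrier_mat n n" and "A \<in> carrier_mat n n" and "B \<in> carrier_mat n n"
  shows "A * matsum n f X * B = matsum n (\<lambda>x. A * f x * B) X"
  using assms
proof (induction X rule: infinite_finite_induct)
  case (insert x X)
  then have f: "f \<in> X \<rightarrow> carrier_mat n n" "f x \<in> carrier_mat n n" by auto
  have g: "(\<lambda>x. A * f x * B) \<in> X \<rightarrow> carrier_mat n n" "A * f x * B \<in> carrier_mat n n"
    using f insert.prems by auto
  have s: "matsum n f X \<in> carrier_mat n n" by (rule matsum_carrier[OF f(1)])
  have "A * (f x + matsum n f X) * B = A * f x * B + A * matsum n f X * B"
    using f(2) s insert.prems
    by (simp add: mult_add_distrib_mat[of A n n] add_mult_distrib_mat[of _ n n])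
  then show ?case using insert f g by (simp add: mat_vs.finsum_insert)
qed auto

text \<open>Multiplying a vanishing combination \<open>\<Sum>l. a l \<cdot> G l\<close> by \<open>X k\<close> on the left and by \<open>Y k\<close> on the
  right isolates the term \<open>a k \<cdot> G k\<close>. For a family of matrix units, the diagonal units belonging to
  the row and to the column of \<open>G k\<close> are such multipliers.\<close>
lemma extractors_imp_independent:
  fixes G :: "'k \<Rightarrow> complex mat"
  assumes "finite K"
    and G: "\<And>k. k \<in> K \<Longrightarrow> G k \<in> carrier_mat n n"
    and X: "\<And>k. k \<in> K \<Longrightarrow> X k \<in> carrier_mat n n"
    and Y: "\<And>k. k \<in> K \<Longrightarrow> Y k \<in> carrier_mat n n"
    and nz: "\<And>k. k \<in> K \<Longrightarrow> G k \<noteq> 0\<^sub>m n n"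
    and ex: "\<And>k l. k \<in> K \<Longrightarrow> l \<in> K \<Longrightarrow> X k * G l * Y k = (if k = l then G k else 0\<^sub>m n n)"
  shows "inj_on G K" and "mat_vs.lin_indpt n (G ` K)"
proof -
  show inj: "inj_on G K"
    by (rule inj_onI) (metis ex nz)
  show "mat_vs.lin_indpt n (G ` K)"
  proof (rule mat_vs.finite_lin_indpt2)
    show "finite (G ` K)" using \<open>finite K\<close> by simp
    show "G ` K \<subseteq> carrier_mat n n" using G by auto
    fix a assume a0: "mat_vs.lincomb n a (G ` K) = 0\<^sub>m n n"
    show "\<forall>v\<in>G ` K. a v = 0"
    proof safe
      fix k assume k: "k \<in> K"
      have s: "mat_vs.lincomb n a (G ` K) = matsum n (\<lambda>l. a (G l) \<cdot>\<^sub>m G l) K"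
        unfolding mat_vs.lincomb_def using inj G by (subst mat_vs.finsum_reindex) auto
      have car: "(\<lambda>l. a (G l) \<cdot>\<^sub>m G l) \<in> K \<rightarrow> carrier_mat n n" using G by auto
      have car2: "(\<lambda>l. X k * (a (G l) \<cdot>\<^sub>m G l) * Y k) \<in> K \<rightarrow> carrier_mat n n"
        using G X[OF k] Y[OF k] by (intro Pi_I mult_carrier_mat[of _ n n _ n]) auto
      from nz[OF k] G[OF k] obtain i j where ij: "i < n" "j < n" "G k $$ (i, j) \<noteq> 0"
        by (metis eq_matI carrier_matD zero_carrier_mat index_zero_mat(1))
      have t: "X k * (a (G l) \<cdot>\<^sub>m G l) * Y k = a (G l) \<cdot>\<^sub>m (if k = l then G k else 0\<^sub>m n n)"
        if "l \<in> K" for l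
      proof -
        have "X k * (a (G l) \<cdot>\<^sub>m G l) * Y k = a (G l) \<cdot>\<^sub>m (X k * G l * Y k)"
          using G[OF that] X[OF k] Y[OF k]
          by (simp add: mult_smult_distrib[of _ n n] mult_smult_assoc_mat[of _ n n])
        then show ?thesis using ex[OF k that] by simp
      qed
      have "0 = (X k * mat_vs.lincomb n a (G ` K) * Y k) $$ (i, j)"
        using a0 X[OF k] Y[OF k] ij by simp
      also have "\<dots> = (\<Sum>l\<in>K. (X k * (a (G l) \<cdot>\<^sub>m G l) * Y k) $$ (i, j))"
        unfolding s mult_matsum_mult[OF car X[OF k] Y[OF k]] index_matsum[OF car2 ij(1,2)] ..
      also have "\<dots> = (\<Sum>l\<in>K. if k = l then a (G k) * G k $$ (i, j) else 0)"
        using ij G[OF k] by (intro sum.cong refl) (auto simp: t)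
      also have "\<dots> = a (G k) * G k $$ (i, j)"
        using \<open>finite K\<close> k by simp
      finally show "a (G k) = 0" using ij by simp
    qed
  qed
qed

text \<open>Spans and linear independence do not change on passing from all matrices to a subspace, so
  both can be checked in the full matrix space.\<close>
lemma basis_of_adjacency_algebra:
  assumes A: "\<A> \<subseteq> carrier_mat n n" and "B \<subseteq> adjacency_algebra n \<A>"
    and "\<A> \<subseteq> adjacency_algebra n B" and ind: "mat_vs.lin_indpt n B"
  shows "vectorspace.basis class_ring (vectorspace.vs (mat_space n) (adjacency_algebra n \<A>)) B"
proof -
  have sub: "VectorSpace.subspace class_ring (adjacency_algebra n \<A>) (mat_space n)"
    unfolding adjacency_algebra_def by (rule mat_vs.span_is_subspace) (use A in auto)
  then have subm: "submodule class_ring (adjacency_algebra n \<A>) (mat_space n)"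
    by (rule mat_vs.is_module)
  interpret W: vectorspace class_ring "(mat_space n)\<lparr>carrier := adjacency_algebra n \<A>\<rparr>"
    using mat_vs.subspace_is_vs[OF sub] by simp
  have "B \<subseteq> carrier_mat n n"
    using \<open>B \<subseteq> adjacency_algebra n \<A>\<close> mat_vs.span_is_subset2[OF A]
    unfolding adjacency_algebra_def by blast
  then have subB: "submodule class_ring (adjacency_algebra n B) (mat_space n)"
    unfolding adjacency_algebra_def
    by (intro mat_vs.is_module mat_vs.span_is_subspace) auto
  have "adjacency_algebra n B = adjacency_algebra n \<A>"
    using mat_vs.span_is_subset[OF assms(2) subm] mat_vs.span_is_subset[OF assms(3) subB]
    unfolding adjacency_algebra_def by blast
  then show ?thesis
    unfolding W.basis_def using mat_vs.span_li_not_depend[OF assms(2) subm] ind assms(2)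
    by (simp add: adjacency_algebra_def)
qed

lemma
  assumes "\<A> \<subseteq> carrier_mat n n"
  shows adjacency_algebra_carrier: "adjacency_algebra n \<A> \<subseteq> carrier_mat n n"
    and adjacency_algebra_generators: "\<A> \<subseteq> adjacency_algebra n \<A>"
    and adjacency_algebra_add:
      "A \<in> adjacency_algebra n \<A> \<Longrightarrow> B \<in> adjacency_algebra n \<A> \<Longrightarrow> A + B \<in> adjacency_algebra n \<A>"
    and adjacency_algebra_smult: "A \<in> adjacency_algebra n \<A> \<Longrightarrow> r \<cdot>\<^sub>m A \<in> adjacency_algebra n \<A>"
    and adjacency_algebra_diff:
      "A \<in> adjacency_algebra n \<A> \<Longrightarrow> B \<in> adjacency_algebra n \<A> \<Longrightarrow> A - B \<in> adjacency_algebra n \<A>"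
    and adjacency_algebra_matsum:
      "f \<in> X \<rightarrow> adjacency_algebra n \<A> \<Longrightarrow> matsum n f X \<in> adjacency_algebra n \<A>"
proof -
  interpret S: submodule class_ring "adjacency_algebra n \<A>" "mat_space n"
    unfolding adjacency_algebra_def by (rule mat_vs.span_is_submodule[OF assms])
  show car: "adjacency_algebra n \<A> \<subseteq> carrier_mat n n"
    unfolding adjacency_algebra_def by (rule mat_vs.span_is_subset2[OF assms])
  show "\<A> \<subseteq> adjacency_algebra n \<A>"
    unfolding adjacency_algebra_def by (rule mat_vs.in_own_span[OF assms])
  show add: "A + B \<in> adjacency_algebra n \<A>"
    if "A \<in> adjacency_algebra n \<A>" "B \<in> adjacency_algebra n \<A>" for A B
    using S.m_closed[OF that] by (simp add: module_mat_simps)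
  show smult: "r \<cdot>\<^sub>m A \<in> adjacency_algebra n \<A>" if "A \<in> adjacency_algebra n \<A>" for r A
    using S.smult_closed[OF _ that, of r] by (simp add: module_mat_simps)
  show "A - B \<in> adjacency_algebra n \<A>"
    if "A \<in> adjacency_algebra n \<A>" "B \<in> adjacency_algebra n \<A>" for A B
  proof -
    have "A - B = A + (- 1) \<cdot>\<^sub>m B"
      using that car by (intro eq_matI) auto
    then show ?thesis using add[OF that(1) smult[OF that(2)]] by simp
  qed
  show "matsum n f X \<in> adjacency_algebra n \<A>" if "f \<in> X \<rightarrow> adjacency_algebra n \<A>" for f :: "'i \<Rightarrow> _" and X
    using that
  proof (induction X rule: infinite_finite_induct)
    case (insert x X)
    then show ?case using car by (subst mat_vs.finsum_insert) (auto intro!: add)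
  qed (use S.zero_closed in \<open>auto simp: module_mat_simps\<close>)
qed

section \<open>Translations of the group \<open>\<int>\<^sub>p\<^sup>m\<close>\<close>

lemma concat_map_nth:
  assumes "\<And>x. x \<in> set xs \<Longrightarrow> length (f x) = k" and "i < length xs * k"
  shows "concat (map f xs) ! i = f (xs ! (i div k)) ! (i mod k)"
  using assms
proof (induction xs arbitrary: i)
  case (Cons x xs)
  show ?case
  proof (cases "i < k")
    case True
    then show ?thesis using Cons.prems by (simp add: nth_append)
  next
    case False
    have k: "k > 0" "k \<le> i" using False Cons.prems(2) by (auto intro: Nat.gr0I)
    note le_div_geq[OF k] le_mod_geq[OF k(2)]
    then show ?thesis using k False Cons.prems Cons.IH[of "i - k"] by (simp add: nth_append)
  qed
qed simp

lemma length_Zp_lex_list: "length (Zp_lex_list p m) = p ^ m"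
proof (induction m)
  case (Suc m)
  have "length (Zp_lex_list p (Suc m)) = (\<Sum>x\<leftarrow>[0..<p]. length (Zp_lex_list p m))"
    by (simp add: Zp_lex_list_def length_concat comp_def)
  then show ?case by (simp add: Suc sum_list_triv)
qed (simp add: Zp_lex_list_def)

text \<open>Lexicographic order makes the position of a vector the number whose base \<open>p\<close> digits are its
  coordinates. This matches the index arithmetic of iterated Kronecker products.\<close>
lemma Zp_lex_list_Suc_nth:
  assumes "i < p ^ Suc m"
  shows "Zp_lex_list p (Suc m) ! i = (i div p ^ m) # (Zp_lex_list p m ! (i mod p ^ m))"
proof -
  have pm: "p ^ m > 0" using assms by (cases p) auto
  have d: "i div p ^ m < p" using assms by (simp add: less_mult_imp_div_less)
  have "Zp_lex_list p (Suc m) ! i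
      = concat (map (\<lambda>x. map ((#) x) (Zp_lex_list p m)) [0..<p]) ! i"
    by (simp add: Zp_lex_list_def)
  also have "\<dots> = map ((#) ([0..<p] ! (i div p ^ m))) (Zp_lex_list p m) ! (i mod p ^ m)"
    by (rule concat_map_nth) (use assms in \<open>simp_all add: length_Zp_lex_list\<close>)
  finally show ?thesis using d pm by (simp add: length_Zp_lex_list)
qed

text \<open>Reversing the enumeration complements every base \<open>p\<close> digit of the position. On vectors, the
  back identity matrix therefore acts as subtraction from \<open>(p - 1, \<dots>, p - 1)\<close>.\<close>
lemma Zp_lex_list_reverse_nth:
  assumes "i < p ^ m"
  shows "map2 (\<lambda>a b. (a + b) mod p) (Zp_lex_list p m ! (p ^ m - 1 - i)) (Zp_lex_list p m ! i)
    = replicate m (p - 1)"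
  using assms
proof (induction m arbitrary: i)
  case 0
  then show ?case by (simp add: Zp_lex_list_def)
next
  case (Suc m)
  define d r where "d = i div p ^ m" and "r = i mod p ^ m"
  have pm: "p ^ m > 0" using Suc.prems by (cases p) auto
  have d: "d < p" using Suc.prems by (simp add: less_mult_imp_div_less d_def)
  have r: "r < p ^ m" using pm by (simp add: r_def)
  have "i = d * p ^ m + r" unfolding d_def r_def by (rule div_mult_mod_eq[symmetric])
  moreover have "p * p ^ m = (p - 1 - d) * p ^ m + d * p ^ m + p ^ m"
  proof -
    have "p = (p - 1 - d) + d + 1" using d by simp
    then show ?thesis by (metis add_mult_distrib mult_1)
  qed
  ultimately have s: "p ^ Suc m - 1 - i = (p - 1 - d) * p ^ m + (p ^ m - 1 - r)"
    using r by simp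
  have less: "p ^ m - 1 - r < p ^ m" using pm by simp
  have *: "(p ^ Suc m - 1 - i) div p ^ m = p - 1 - d"
    "(p ^ Suc m - 1 - i) mod p ^ m = p ^ m - 1 - r"
    unfolding s using pm less by simp_all
  have "p ^ Suc m - 1 - i < p ^ Suc m" using Suc.prems by simp
  from Zp_lex_list_Suc_nth[OF this] Zp_lex_list_Suc_nth[OF Suc.prems] Suc.IH[OF r] d
  show ?case unfolding * d_def[symmetric] r_def[symmetric] by simp
qed

lemma shift_mat_pow_index:
  assumes "i < p" and "j < p"
  shows "(shift_mat p ^\<^sub>m x) $$ (i, j) = (if j = (i + x) mod p then 1 else 0)"
  using assms
proof (induction x arbitrary: j)
  case 0
  then show ?case by (auto simp: shift_mat_def)
next
  case (Suc x)
  have car: "shift_mat p \<in> carrier_mat p p" by (simp add: shift_mat_def)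
  have "(shift_mat p ^\<^sub>m Suc x) $$ (i, j)
      = (\<Sum>k<p. (shift_mat p ^\<^sub>m x) $$ (i, k) * shift_mat p $$ (k, j))"
    using Suc.prems car pow_carrier_mat[OF car, of x]
    by (auto simp: scalar_prod_def lessThan_atLeast0 intro!: sum.cong)
  also have "\<dots> = (\<Sum>k<p. if k = (i + x) mod p then (if j = (k + 1) mod p then 1 else 0) else 0)"
    using Suc by (intro sum.cong) (auto simp: shift_mat_def)
  also have "\<dots> = (if j = (i + Suc x) mod p then 1 else 0)"
    using Suc.prems by (simp add: mod_Suc_eq)
  finally show ?case .
qed

lemma dim_kronecker: "dim_row (A \<otimes>\<^sub>m B) = dim_row A * dim_row B"
    "dim_col (A \<otimes>\<^sub>m B) = dim_col A * dim_col B"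
  by (simp_all add: kronecker_mat_def)

lemma index_kronecker:
  "i < dim_row A * dim_row B \<Longrightarrow> j < dim_col A * dim_col B \<Longrightarrow> (A \<otimes>\<^sub>m B) $$ (i, j)
   = A $$ (i div dim_row B, j div dim_col B) * B $$ (i mod dim_row B, j mod dim_col B)"
  by (simp add: kronecker_mat_def)

lemma dim_shift_mat [simp]: "dim_row (shift_mat p) = p" "dim_col (shift_mat p) = p"
  by (simp_all add: shift_mat_def)

lemma phi_list_dim: "dim_row (phi_list p xs) = p ^ length xs" "dim_col (phi_list p xs) = p ^ length xs"
  by (induction xs) (auto simp: phi_list_def dim_kronecker)

text \<open>\<open>\<phi>(x)\<close> is the translation by \<open>x\<close>: each Kronecker factor translates one coordinate.\<close>
lemma phi_list_index:
  assumes "i < p ^ length xs" and "j < p ^ length xs"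
  shows "phi_list p xs $$ (i, j)
    = (if Zp_lex_list p (length xs) ! j
          = map2 (\<lambda>a b. (a + b) mod p) (Zp_lex_list p (length xs) ! i) xs then 1 else 0)"
  using assms
proof (induction xs arbitrary: i j)
  case Nil
  then show ?case by (simp add: phi_list_def Zp_lex_list_def)
next
  case (Cons x xs)
  let ?m = "length xs"
  have phi_Cons: "phi_list p (x # xs) = (shift_mat p ^\<^sub>m x) \<otimes>\<^sub>m phi_list p xs"
    by (simp add: phi_list_def)
  have pm: "p ^ ?m > 0" using Cons.prems by (cases p) auto
  have d: "i div p ^ ?m < p" "j div p ^ ?m < p"
    using Cons.prems by (simp_all add: less_mult_imp_div_less)
  have "phi_list p (x # xs) $$ (i, j)
      = (shift_mat p ^\<^sub>m x) $$ (i div p ^ ?m, j div p ^ ?m) * phi_list p xs $$ (i mod p ^ ?m, j mod p ^ ?m)"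
    unfolding phi_Cons using Cons.prems by (subst index_kronecker) (simp_all add: phi_list_dim)
  also have "\<dots> = (if j div p ^ ?m = (i div p ^ ?m + x) mod p then 1 else 0) *
    (if Zp_lex_list p ?m ! (j mod p ^ ?m)
          = map2 (\<lambda>a b. (a + b) mod p) (Zp_lex_list p ?m ! (i mod p ^ ?m)) xs then 1 else 0)"
    unfolding shift_mat_pow_index[OF d] using pm by (subst Cons.IH) simp_all
  finally have "phi_list p (x # xs) $$ (i, j) = \<dots>" .
  moreover have "Zp_lex_list p (Suc ?m) ! i = (i div p ^ ?m) # Zp_lex_list p ?m ! (i mod p ^ ?m)"
    "Zp_lex_list p (Suc ?m) ! j = (j div p ^ ?m) # Zp_lex_list p ?m ! (j mod p ^ ?m)"
    using Cons.prems by (auto intro!: Zp_lex_list_Suc_nth simp del: power_Suc)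
  ultimately show ?case by simp
qed

section \<open>The enumeration of the field\<close>

locale field_coordinates =
  fixes p m q :: nat and c :: "'a::{field,finite} \<Rightarrow> nat list"
  assumes prime: "prime p" and odd: "odd p" and q: "q = p ^ m" and card_q [simp]: "CARD('a) = q"
    and ident: "additive_identification p m c"
begin

abbreviation e :: "nat \<Rightarrow> 'a" where "e \<equiv> nth_elem p m c"

abbreviation \<chi> :: "'a \<Rightarrow> 'a \<Rightarrow> complex" where "\<chi> \<equiv> character p c"

lemma p_pos: "p > 0" using prime by (rule prime_gt_0_nat)

lemma q_pos: "q > 0" using p_pos by (simp add: q)

lemma c_bij: "bij_betw c UNIV {xs. length xs = m \<and> set xs \<subseteq> {..<p}}"
  and c_add: "c (x + y) = map2 (\<lambda>a b. (a + b) mod p) (c x) (c y)"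
  using ident by (auto simp: additive_identification_def)

lemma inj_c: "inj c" using c_bij by (auto simp: bij_betw_def)

lemma length_c [simp]: "length (c x) = m"
  using c_bij by (auto simp: bij_betw_def)

lemma c_nth_less: "i < m \<Longrightarrow> c x ! i < p"
proof -
  assume "i < m"
  then have "c x ! i \<in> set (c x)" by simp
  moreover have "c x \<in> {xs. length xs = m \<and> set xs \<subseteq> {..<p}}"
    using bij_betw_imp_surj_on[OF c_bij] by blast
  ultimately show ?thesis by blast
qed

lemma c_surj: "length xs = m \<Longrightarrow> set xs \<subseteq> {..<p} \<Longrightarrow> \<exists>x. c x = xs"
proof -
  assume "length xs = m" "set xs \<subseteq> {..<p}"
  then have "xs \<in> range c" unfolding bij_betw_imp_surj_on[OF c_bij] by simp
  then show ?thesis by blast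
qed

lemma c_zero: "c 0 = replicate m 0"
proof (rule nth_equalityI)
  fix i assume "i < length (c 0)"
  then have i: "i < m" by simp
  have "c (0 + 0) ! i = (c 0 ! i + c 0 ! i) mod p"
    unfolding c_add using i by simp
  then have "(c 0 ! i + c 0 ! i) mod p = (c 0 ! i) mod p" using c_nth_less[OF i, of 0] by simp
  then have "p dvd c 0 ! i"
    by (metis add_diff_cancel_left' le_add1 mod_eq_dvd_iff_nat)
  then show "c 0 ! i = replicate m 0 ! i" using c_nth_less[OF i, of 0] i
    by (auto dest: dvd_imp_le)
qed simp

lemma c_e: "i < q \<Longrightarrow> c (e i) = Zp_lex_list p m ! i"
proof -
  assume "i < q"
  then have "Zp_lex_list p m ! i \<in> set (Zp_lex_list p m)"
    by (simp add: q length_Zp_lex_list)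
  then have "Zp_lex_list p m ! i \<in> range c"
    unfolding set_Zp_lex_list using c_bij by (simp add: bij_betw_def)
  then show ?thesis unfolding nth_elem_def by (rule f_inv_into_f)
qed

lemma distinct_Zp_lex_list: "distinct (Zp_lex_list p m)"
proof -
  have "card (set (Zp_lex_list p m)) = q"
    unfolding set_Zp_lex_list using bij_betw_same_card[OF c_bij] by simp
  then show ?thesis by (simp add: card_distinct q length_Zp_lex_list)
qed

lemma e_bij: "bij_betw e {..<q} UNIV"
proof -
  have "inj_on e {..<q}"
  proof (rule inj_onI)
    fix i j assume "i \<in> {..<q}" "j \<in> {..<q}" "e i = e j"
    then have "Zp_lex_list p m ! i = Zp_lex_list p m ! j" by (metis c_e lessThan_iff)
    then show "i = j" using \<open>i \<in> _\<close> \<open>j \<in> _\<close> distinct_Zp_lex_list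
      by (simp add: nth_eq_iff_index_eq q length_Zp_lex_list)
  qed
  then show ?thesis by (simp add: bij_betw_def card_image card_subset_eq)
qed

lemma phi_dim [simp]: "dim_row (phi p c x) = q" "dim_col (phi p c x) = q"
  by (simp_all add: phi_def phi_list_dim q)

lemma phi_index:
  assumes "i < q" and "j < q"
  shows "phi p c x $$ (i, j) = (if e j = e i + x then 1 else 0)"
proof -
  have "e j = e i + x \<longleftrightarrow> c (e j) = c (e i + x)" using inj_c by (simp add: inj_eq)
  then show ?thesis
    using assms phi_list_index[of i p "c x" j] by (simp add: phi_def q c_e c_add)
qed

text \<open>The reversal of the enumeration is \<open>x \<mapsto> k - x\<close> with \<open>k = (p - 1, \<dots>, p - 1)\<close>. Since \<open>p\<close> is
  odd, doubling is injective, hence \<open>k = h + h\<close>, and the reversal is the point reflection at \<open>h\<close>.\<close>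
lemma ex_centre: "\<exists>h. \<forall>i<q. e (q - 1 - i) = h + h - e i"
proof -
  have dbl: "inj (\<lambda>x::'a. x + x)"
  proof (rule injI)
    fix x y :: 'a assume "x + x = y + y"
    then have z: "(x - y) + (x - y) = 0" by (simp add: algebra_simps)
    have "c (x - y) = c 0"
    proof (rule nth_equalityI)
      fix i assume "i < length (c (x - y))"
      then have i: "i < m" by simp
      have "(c (x - y) ! i + c (x - y) ! i) mod p = c ((x - y) + (x - y)) ! i"
        unfolding c_add using i by simp
      also have "\<dots> = 0" unfolding z using i by (simp add: c_zero)
      finally have "p dvd 2 * c (x - y) ! i" by (simp add: mult_2 mod_eq_0_iff_dvd)
      moreover have "coprime p 2" using odd by (simp add: coprime_right_2_iff_odd)
      ultimately have "p dvd c (x - y) ! i" by (simp add: coprime_dvd_mult_right_iff)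
      then show "c (x - y) ! i = c 0 ! i" using c_nth_less[OF i, of "x - y"] i
        by (auto simp: c_zero dest: dvd_imp_le)
    qed simp
    then show "x = y" using inj_c by (simp add: inj_eq)
  qed
  then have "surj (\<lambda>x::'a. x + x)" by (simp add: finite_UNIV_inj_surj)
  moreover obtain k where k: "c k = replicate m (p - 1)"
  proof -
    have "set (replicate m (p - 1)) \<subseteq> {..<p}"
      using p_pos by (cases m) auto
    then show thesis using c_surj[OF length_replicate] that by blast
  qed
  ultimately obtain h where h: "k = h + h" by (metis surjD)
  have "e (q - 1 - i) = h + h - e i" if "i < q" for i
  proof -
    have "c (e (q - 1 - i) + e i) = c (h + h)"
      unfolding c_add[of "e _"] h[symmetric] k
      using Zp_lex_list_reverse_nth[of i p m] that by (simp add: c_e q[symmetric])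
    then show ?thesis using inj_c by (simp add: inj_eq algebra_simps)
  qed
  then show ?thesis by blast
qed

definition centre :: 'a where "centre = (SOME h. \<forall>i<q. e (q - 1 - i) = h + h - e i)"

lemma e_reversed: "i < q \<Longrightarrow> e (q - 1 - i) = centre + centre - e i"
  using someI_ex[OF ex_centre] unfolding centre_def by blast

section \<open>Characters\<close>

definition zeta :: complex where "zeta = exp (2 * of_real pi * \<i> / of_nat p)"

lemma zeta_cis: "zeta = cis (2 * pi / p)"
  by (simp add: zeta_def cis_conv_exp mult_ac)

lemma zeta_pow_mod: "zeta ^ n = zeta ^ (n mod p)"
proof -
  have "zeta ^ p = 1" using p_pos by (simp add: zeta_cis DeMoivre)
  then have "zeta ^ (p * (n div p) + n mod p) = zeta ^ (n mod p)"
    by (simp only: power_add power_mult power_one mult_1)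
  then show ?thesis by simp
qed

lemma zeta_pow_neq_1: "0 < n \<Longrightarrow> n < p \<Longrightarrow> zeta ^ n \<noteq> 1"
proof
  assume n: "0 < n" "n < p" and "zeta ^ n = 1"
  then have "cis (2 * pi * n / p) = 1" by (simp add: zeta_cis DeMoivre mult_ac)
  then have "cos (2 * pi * n / p) = 1" by (metis cis.sel(1) one_complex.sel(1))
  then obtain k :: int where "2 * pi * n / p = k * 2 * pi" using cos_one_2pi_int by auto
  then have "real n / p = k" using p_pos by (simp add: field_simps)
  moreover have "0 < real n / p" "real n / p < 1" using n by simp_all
  ultimately show False by simp
qed

lemma zeta_cnj: "cnj (zeta ^ n) * zeta ^ n = 1"
  by (simp add: zeta_cis DeMoivre cis_cnj cis_mult)

lemma chi_prod: "\<chi> x y = (\<Prod>i<m. zeta ^ (c x ! i * c y ! i))"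
proof -
  have "sum_list (map2 (*) (c y) (c x)) = (\<Sum>i<m. c x ! i * c y ! i)"
    by (simp add: sum_list_sum_nth lessThan_atLeast0 mult.commute)
  then show ?thesis by (simp add: character_def zeta_def[symmetric] power_sum)
qed

lemma chi_sym: "\<chi> x y = \<chi> y x"
  by (simp add: chi_prod mult.commute)

lemma chi_add_left: "\<chi> (x + y) z = \<chi> x z * \<chi> y z"
proof -
  have "zeta ^ (c (x + y) ! i * c z ! i) = zeta ^ (c x ! i * c z ! i) * zeta ^ (c y ! i * c z ! i)" if "i < m" for i
  proof -
    have "zeta ^ (c (x + y) ! i * c z ! i) = zeta ^ (((c x ! i + c y ! i) mod p * c z ! i) mod p)"
      unfolding c_add using that by (subst zeta_pow_mod) simp
    also have "\<dots> = zeta ^ ((c x ! i + c y ! i) * c z ! i)"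
      by (simp only: mod_mult_left_eq zeta_pow_mod[symmetric])
    finally show ?thesis by (simp add: distrib_right power_add)
  qed
  then show ?thesis by (simp add: chi_prod prod.distrib)
qed

lemma chi_add: "\<chi> x (y + z) = \<chi> x y * \<chi> x z"
  by (metis chi_sym chi_add_left)

lemma chi_zero [simp]: "\<chi> 0 x = 1" "\<chi> x 0 = 1"
  by (simp_all add: chi_prod c_zero)

lemma chi_nonzero [simp]: "\<chi> x y \<noteq> 0"
  by (simp add: chi_prod zeta_def)

lemma chi_minus: "\<chi> x (- y) = inverse (\<chi> x y)" "\<chi> (- x) y = inverse (\<chi> x y)"
proof -
  show "\<chi> x (- y) = inverse (\<chi> x y)"
    by (rule inverse_unique[symmetric]) (simp add: chi_add[symmetric])
  show "\<chi> (- x) y = inverse (\<chi> x y)"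
    by (rule inverse_unique[symmetric]) (simp add: chi_add_left[symmetric])
qed

lemma chi_diff: "\<chi> x (y - z) = \<chi> x y / \<chi> x z"
  using chi_add[of x y "- z"] by (simp add: chi_minus divide_inverse)

lemma cnj_chi: "cnj (\<chi> x y) = inverse (\<chi> x y)"
proof -
  have "\<chi> x y * cnj (\<chi> x y) = (\<Prod>i<m. cnj (zeta ^ (c x ! i * c y ! i)) * zeta ^ (c x ! i * c y ! i))"
    unfolding chi_prod by (simp add: prod.distrib mult.commute)
  also have "\<dots> = 1" unfolding zeta_cnj by simp
  finally show ?thesis by (simp add: inverse_unique)
qed

text \<open>If the \<open>i\<close>-th coordinate of \<open>x\<close> is nonzero, the \<open>i\<close>-th unit vector pairs with \<open>x\<close> to an exponent
  strictly between \<open>0\<close> and \<open>p\<close>.\<close>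
lemma chi_nontrivial:
  assumes "x \<noteq> 0"
  shows "\<exists>y. \<chi> x y \<noteq> 1"
proof -
  have "c x \<noteq> c 0" using assms inj_c by (simp add: inj_eq)
  then obtain i where i: "i < m" "c x ! i \<noteq> 0"
    by (metis c_zero length_c nth_equalityI nth_replicate)
  have "1 < p" using prime by (rule prime_gt_1_nat)
  then have "set ((replicate m 0)[i := 1]) \<subseteq> {..<p}"
    by (auto dest!: set_update_subset_insert[THEN subsetD])
  then obtain y where y: "c y = (replicate m 0)[i := 1]"
    using c_surj[of "(replicate m 0)[i := 1]"] by auto
  have "\<chi> x y = (\<Prod>j<m. if j = i then zeta ^ (c x ! i) else 1)"
    unfolding chi_prod using i by (intro prod.cong) (auto simp: y nth_list_update)
  also have "\<dots> = zeta ^ (c x ! i)" using i by simp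
  finally show ?thesis using zeta_pow_neq_1[of "c x ! i"] c_nth_less[OF i(1), of x] i
    by (intro exI[of _ y]) simp
qed

text \<open>Translating the summation variable by some \<open>z\<close> with \<open>\<chi> x z \<noteq> 1\<close> multiplies the sum by
  \<open>\<chi> x z\<close>, which forces it to vanish.\<close>
lemma sum_chi: "(\<Sum>y\<in>UNIV. \<chi> x y) = (if x = 0 then of_nat q else 0)"
proof (cases "x = 0")
  case False
  then obtain z where z: "\<chi> x z \<noteq> 1" using chi_nontrivial by blast
  have "(\<Sum>y\<in>UNIV. \<chi> x y) = (\<Sum>y\<in>UNIV. \<chi> x (z + y))"
    by (rule sum.reindex_bij_witness[of _ "\<lambda>y. z + y" "\<lambda>y. y - z"]) auto
  also have "\<dots> = \<chi> x z * (\<Sum>y\<in>UNIV. \<chi> x y)"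
    by (simp add: chi_add sum_distrib_left)
  finally show ?thesis using z False by simp
qed simp

lemma sum_chi_minus: "(\<Sum>y\<in>UNIV. \<chi> x (- y)) = (if x = 0 then of_nat q else 0)"
proof -
  have "(\<Sum>y\<in>UNIV. \<chi> x (- y)) = (\<Sum>y\<in>UNIV. \<chi> x y)"
    by (rule sum.reindex_bij_witness[of _ uminus uminus]) auto
  then show ?thesis by (simp add: sum_chi)
qed

lemma sum_chi_mult:
  assumes "x \<noteq> 0"
  shows "(\<Sum>y\<in>UNIV. \<chi> x (d * y)) = (if d = 0 then of_nat q else 0)"
proof (cases "d = 0")
  case False
  have "(\<Sum>y\<in>UNIV. \<chi> x (d * y)) = (\<Sum>y\<in>UNIV. \<chi> x y)"
    by (rule sum.reindex_bij_witness[of _ "\<lambda>y. y / d" "\<lambda>y. d * y"]) (use False in auto)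
  then show ?thesis using assms False by (simp add: sum_chi)
qed simp

lemma sum_chi_left: "(\<Sum>x\<in>UNIV. \<chi> x y) = (if y = 0 then of_nat q else 0)"
  using sum_chi[of y] by (simp add: chi_sym)

end

section \<open>The Latin square\<close>

locale latin_scheme = field_coordinates p m q c
  for p m q :: nat and c :: "'a::{field,finite} \<Rightarrow> nat list" +
  fixes L :: "'a option mat"
  assumes latin: "symmetric_latin_square L"
begin

definition N :: nat where "N = (q + 1) * q^2"

text \<open>The symbol of the Latin square off the diagonal. On the diagonal, where the symbol is the
  indeterminate, the value is arbitrary, and all uses are guarded by \<open>b \<noteq> b'\<close>.\<close>
definition label :: "nat \<Rightarrow> nat \<Rightarrow> 'a" where "label b b' = the (L $$ (b, b'))"

lemma L_dim: "dim_row L = q + 1" "dim_col L = q + 1"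
  using latin by (auto simp: symmetric_latin_square_def latin_square_def)

lemma L_diag: "b \<le> q \<Longrightarrow> L $$ (b, b) = None"
  using latin by (simp add: symmetric_latin_square_def)

lemma L_row: "b \<le> q \<Longrightarrow> bij_betw (\<lambda>b'. L $$ (b, b')) {..q} UNIV"
  using latin by (simp add: symmetric_latin_square_def latin_square_def lessThan_Suc_atMost)

lemma L_label:
  assumes "b \<le> q" and "b' \<le> q" and "b \<noteq> b'"
  shows "L $$ (b, b') = Some (label b b')"
proof -
  have "L $$ (b, b') \<noteq> L $$ (b, b)"
    using inj_onD[OF bij_betw_imp_inj_on[OF L_row[OF assms(1)]]] assms by fastforce
  then show ?thesis using assms by (simp add: L_diag label_def)
qed

lemma label_sym: "b \<le> q \<Longrightarrow> b' \<le> q \<Longrightarrow> label b b' = label b' b"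
proof -
  assume "b \<le> q" "b' \<le> q"
  then have "transpose_mat L $$ (b, b') = L $$ (b', b)" by (simp add: L_dim)
  then show ?thesis using latin by (simp add: label_def symmetric_latin_square_def)
qed

text \<open>The indeterminate takes up the diagonal position of the row, so each field element occurs
  exactly once among the other positions.\<close>
lemma label_bij:
  assumes "b \<le> q"
  shows "bij_betw (label b) ({..q} - {b}) UNIV"
proof -
  have inj: "inj_on (label b) ({..q} - {b})"
  proof (rule inj_onI)
    fix x y assume "x \<in> {..q} - {b}" "y \<in> {..q} - {b}" "label b x = label b y"
    then have "L $$ (b, x) = L $$ (b, y)" using assms by (simp add: L_label)
    then show "x = y"
      using inj_onD[OF bij_betw_imp_inj_on[OF L_row[OF assms]]] \<open>x \<in> _\<close> \<open>y \<in> _\<close> by blast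
  qed
  have "card (label b ` ({..q} - {b})) = q" using inj assms by (simp add: card_image)
  then show ?thesis using inj by (simp add: bij_betw_def card_subset_eq)
qed

lemma label_inj:
  assumes "b \<le> q" "x \<le> q" "y \<le> q" "x \<noteq> b" "y \<noteq> b"
  shows "label b x = label b y \<longleftrightarrow> x = y"
  using bij_betw_imp_inj_on[OF label_bij[OF assms(1)]] assms by (auto simp: inj_on_def)

section \<open>Matrices as kernels\<close>

text \<open>A row index stands for a block \<open>b\<close> of size \<open>q\<^sup>2\<close>, a fibre \<open>B\<close> of size \<open>q\<close> in this block and a
  position \<open>Y\<close> in this fibre. Measuring \<open>B\<close> and \<open>Y\<close> from the centre of reflection turns the back
  identity matrix into negation of both.\<close>
definition point :: "nat \<Rightarrow> nat \<times> 'a \<times> 'a" where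
  "point i = (i div q^2, e (i div q mod q) - centre, e (i mod q) - centre)"

abbreviation points :: "(nat \<times> 'a \<times> 'a) set" where "points \<equiv> {..q} \<times> UNIV"

lemma div_q2: "(i::nat) div q^2 = i div q div q"
  by (simp add: power2_eq_square div_mult2_eq)

lemma mod_q2_div: "(i::nat) mod q^2 div q = i div q mod q"
  using q_pos by (simp add: power2_eq_square mod_mult2_eq)

lemma mod_q2_mod: "(i::nat) mod q^2 mod q = i mod q"
  by (simp add: power2_eq_square mod_mod_cancel)

lemma nat_eq_iff_digits: "(i::nat) = j \<longleftrightarrow> i div q = j div q \<and> i mod q = j mod q"
proof
  assume "i div q = j div q \<and> i mod q = j mod q"
  then have "i div q * q + i mod q = j div q * q + j mod q" by simp
  then show "i = j" by (simp only: div_mult_mod_eq)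
qed simp

lemma block_less: "i < N \<Longrightarrow> i div q^2 < q + 1"
  unfolding N_def by (rule less_mult_imp_div_less)

lemma e_inj: "i < q \<Longrightarrow> j < q \<Longrightarrow> e i = e j \<longleftrightarrow> i = j"
  using bij_betw_imp_inj_on[OF e_bij] by (auto simp: inj_on_def)

lemma point_in: "i < N \<Longrightarrow> point i \<in> points"
  using block_less[of i] by (simp add: point_def)

lemma point_bij: "bij_betw point {..<N} points"
proof -
  have inj: "inj_on point {..<N}"
  proof (rule inj_onI)
    fix i j assume "point i = point j"
    then have "i div q div q = j div q div q" "i div q mod q = j div q mod q" "i mod q = j mod q"
      using q_pos by (simp_all add: point_def e_inj div_q2)
    then show "i = j" by (simp add: nat_eq_iff_digits[of i j] nat_eq_iff_digits[of "i div q"])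
  qed
  have "card points = N"
    unfolding UNIV_Times_UNIV[symmetric] card_cartesian_product by (simp add: power2_eq_square N_def)
  moreover have "point ` {..<N} \<subseteq> points" using point_in by blast
  ultimately have "point ` {..<N} = points"
    using inj by (intro card_subset_eq) (simp_all add: card_image)
  then show ?thesis using inj by (simp add: bij_betw_def)
qed

definition kernel_mat :: "(nat \<times> 'a \<times> 'a \<Rightarrow> nat \<times> 'a \<times> 'a \<Rightarrow> complex) \<Rightarrow> complex mat" where
  "kernel_mat f = mat N N (\<lambda>(i, j). f (point i) (point j))"

lemma kernel_mat_carrier [simp]: "kernel_mat f \<in> carrier_mat N N" by (simp add: kernel_mat_def)

lemma kernel_mat_dim [simp]: "dim_row (kernel_mat f) = N" "dim_col (kernel_mat f) = N" by (simp_all add: kernel_mat_def)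

lemma kernel_mat_index: "i < N \<Longrightarrow> j < N \<Longrightarrow> kernel_mat f $$ (i, j) = f (point i) (point j)"
  by (simp add: kernel_mat_def)

lemma kernel_mat_cong:
  assumes "\<And>x y. x \<in> points \<Longrightarrow> y \<in> points \<Longrightarrow> f x y = g x y"
  shows "kernel_mat f = kernel_mat g"
  using assms by (intro eq_matI) (simp_all add: kernel_mat_index point_in)

lemma kernel_mat_eqI:
  assumes "A \<in> carrier_mat N N"
    and "\<And>i j. i < N \<Longrightarrow> j < N \<Longrightarrow> A $$ (i, j) = f (point i) (point j)"
  shows "A = kernel_mat f"
  using assms by (auto simp: kernel_mat_def intro!: eq_matI)

lemma kernel_mat_mult: "kernel_mat f * kernel_mat g = kernel_mat (\<lambda>x z. \<Sum>y\<in>points. f x y * g y z)"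
proof (rule kernel_mat_eqI)
  fix i j assume ij: "i < N" "j < N"
  then have "(kernel_mat f * kernel_mat g) $$ (i, j) = (\<Sum>k<N. f (point i) (point k) * g (point k) (point j))"
    by (auto simp: scalar_prod_def kernel_mat_index lessThan_atLeast0 simp del: mult_Suc intro!: sum.cong)
  also have "\<dots> = (\<Sum>y\<in>points. f (point i) y * g y (point j))"
    by (rule sum.reindex_bij_betw[OF point_bij])
  finally show "(kernel_mat f * kernel_mat g) $$ (i, j) = (\<Sum>y\<in>points. f (point i) y * g y (point j))" .
qed (rule mult_carrier_mat[of _ N N]; simp)

lemma sum_points: "(\<Sum>x\<in>points. f x) = (\<Sum>b\<le>q. \<Sum>B\<in>UNIV. \<Sum>Y\<in>UNIV. f (b, B, Y))"
  unfolding UNIV_Times_UNIV[symmetric] by (simp only: sum.cartesian_product split_def prod.collapse)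

lemma kernel_mat_zero: "0\<^sub>m N N = kernel_mat (\<lambda>_ _. 0)"
  by (rule kernel_mat_eqI) simp_all

lemma kernel_mat_smult: "r \<cdot>\<^sub>m kernel_mat f = kernel_mat (\<lambda>x y. r * f x y)"
  by (rule kernel_mat_eqI) (simp_all add: kernel_mat_index)

lemma kernel_mat_add: "kernel_mat f + kernel_mat g = kernel_mat (\<lambda>x y. f x y + g x y)"
  by (rule kernel_mat_eqI) (simp_all add: kernel_mat_index)

lemma kernel_mat_diff: "kernel_mat f - kernel_mat g = kernel_mat (\<lambda>x y. f x y - g x y)"
  by (rule kernel_mat_eqI) (simp_all add: kernel_mat_index minus_carrier_mat)

lemma kernel_mat_adjoint: "mat_adjoint (kernel_mat f) = kernel_mat (\<lambda>x y. cnj (f y x))"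
  by (rule kernel_mat_eqI)
    (auto simp: mat_adjoint_def mat_of_rows_def kernel_mat_index cols_def col_def vec_index_conjugate)

lemma kernel_mat_nonzero:
  assumes "x \<in> points" "y \<in> points" "f x y \<noteq> 0"
  shows "kernel_mat f \<noteq> 0\<^sub>m N N"
proof
  assume *: "kernel_mat f = 0\<^sub>m N N"
  have "x \<in> point ` {..<N}" "y \<in> point ` {..<N}"
    unfolding bij_betw_imp_surj_on[OF point_bij] by (rule assms)+
  then obtain i j where "i < N" "j < N" "point i = x" "point j = y" by blast
  then show False using * assms(3) kernel_mat_index[of i j f] by simp
qed

lemma kernel_mat_matsum: "finite X \<Longrightarrow> matsum N (\<lambda>x. kernel_mat (f x)) X = kernel_mat (\<lambda>y z. \<Sum>x\<in>X. f x y z)"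
  by (rule kernel_mat_eqI) (auto intro!: matsum_carrier simp: index_matsum kernel_mat_index)

section \<open>Kernels of the scheme\<close>

lemma all_ones_eq_kernel_mat: "all_ones_mat N = kernel_mat (\<lambda>_ _. 1)"
  by (rule kernel_mat_eqI) (simp_all add: all_ones_mat_def)

lemma A0_eq_kernel_mat: "A0 p c \<gamma> = kernel_mat (\<lambda>(b, B, Y) (b', B', Y'). of_bool (b = b' \<and> B = B' \<and> Y' - Y = \<gamma>))"
proof (rule kernel_mat_eqI)
  have s: "q * (q + 1) * q = N" by (simp add: N_def power2_eq_square algebra_simps)
  show "A0 p c \<gamma> \<in> carrier_mat N N"
    by (simp only: A0_def Let_def card_q carrier_mat_def mem_Collect_eq dim_kronecker phi_dim
        index_one_mat s)
  fix i j assume ij: "i < N" "j < N"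
  have d: "k div q < q * (q + 1)" if "k < N" for k
    using that unfolding s[symmetric] by (rule less_mult_imp_div_less)
  have m: "i mod q < q" "j mod q < q" using q_pos by simp_all
  have "A0 p c \<gamma> $$ (i, j) = (1\<^sub>m (q * (q + 1)) $$ (i div q, j div q)) * phi p c \<gamma> $$ (i mod q, j mod q)"
    unfolding A0_def Let_def card_q using ij
    by (subst index_kronecker) (simp_all only: s phi_dim index_one_mat)
  also have "\<dots> = of_bool (i div q = j div q \<and> e (j mod q) = e (i mod q) + \<gamma>)"
    unfolding phi_index[OF m] by (simp only: index_one_mat d ij) simp
  also have "i div q = j div q \<longleftrightarrow> i div q div q = j div q div q \<and> i div q mod q = j div q mod q"
    by (rule nat_eq_iff_digits)
  finally show "A0 p c \<gamma> $$ (i, j)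
    = (case point i of (b, B, Y) \<Rightarrow> \<lambda>(b', B', Y'). of_bool (b = b' \<and> B = B' \<and> Y' - Y = \<gamma>)) (point j)"
    using q_pos by (auto simp: point_def e_inj div_q2 algebra_simps)
qed

lemma A2_eq_kernel_mat: "A2 q = kernel_mat (\<lambda>(b, B, Y) (b', B', Y'). of_bool (b = b' \<and> B \<noteq> B'))"
proof (rule kernel_mat_eqI)
  let ?M = "all_ones_mat (q^2) - 1\<^sub>m q \<otimes>\<^sub>m all_ones_mat q"
  have dim: "dim_row ?M = q^2" "dim_col ?M = q^2"
    by (simp_all add: dim_kronecker all_ones_mat_def power2_eq_square)
  have M: "?M $$ (r, s) = of_bool (r div q \<noteq> s div q)" if "r < q^2" "s < q^2" for r s
  proof -
    have "r div q < q" "s div q < q"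
      using that by (simp_all add: power2_eq_square less_mult_imp_div_less)
    then show ?thesis using that q_pos
      by (simp add: index_kronecker dim_kronecker all_ones_mat_def power2_eq_square)
  qed
  show "A2 q \<in> carrier_mat N N"
    unfolding A2_def carrier_mat_def by (simp only: mem_Collect_eq dim_kronecker[of "1\<^sub>m (q + 1)"] dim index_one_mat N_def)
  fix i j assume ij: "i < N" "j < N"
  have "A2 q $$ (i, j) = 1\<^sub>m (q + 1) $$ (i div q^2, j div q^2) * ?M $$ (i mod q^2, j mod q^2)"
    unfolding A2_def using ij by (subst index_kronecker) (simp_all only: dim index_one_mat N_def)
  also have "\<dots> = of_bool (i div q^2 = j div q^2 \<and> i div q mod q \<noteq> j div q mod q)"
    using ij block_less[of i] block_less[of j] q_pos by (simp add: M mod_q2_div)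
  finally show "A2 q $$ (i, j)
    = (case point i of (b, B, Y) \<Rightarrow> \<lambda>(b', B', Y'). of_bool (b = b' \<and> B \<noteq> B')) (point j)"
    using q_pos by (simp add: point_def e_inj)
qed

lemma eq_add_add_iff: "x = y + (z + g) \<longleftrightarrow> x - y - z = g" for x y z g :: 'a
proof
  assume "x - y - z = g"
  then show "x = y + (z + g)" by (auto simp: algebra_simps)
qed simp

text \<open>Reversing the columns negates both centred coordinates of the column, so the condition
  \<open>Y' - Y = a (B' - B) + \<gamma>\<close> of \<open>C\<close> becomes \<open>- Y' - Y = a (- B' - B) + \<gamma>\<close>. The result is symmetric in
  the two points, and this symmetry is what makes \<open>F1_adjoint\<close> true.\<close>
lemma C_reversed_index:
  assumes r: "r < q^2" and s: "s < q^2"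
  shows "(C_mat p m c a \<gamma> * back_identity_mat (q^2)) $$ (r, s) = of_bool
    (a * ((e (r div q) - centre) + (e (s div q) - centre)) - (e (r mod q) - centre) - (e (s mod q) - centre) = \<gamma>)"
proof -
  have car: "C_mat p m c a \<gamma> \<in> carrier_mat (q^2) (q^2)" by (simp add: C_mat_def)
  have d: "r div q < q" "s div q < q" "r mod q < q" "s mod q < q"
    using r s q_pos by (simp_all add: power2_eq_square less_mult_imp_div_less)
  have d5: "q - 1 - s mod q < q" using q_pos by linarith
  let ?t = "q^2 - 1 - s"
  \<comment> \<open>The base \<open>q\<close> digits of the reversed index are the complementary digits.\<close>
  have t: "?t = (q - 1 - s div q) * q + (q - 1 - s mod q)"
  proof -
    define u v where "u = q - 1 - s div q" and "v = q - 1 - s mod q"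
    have "s div q + u + 1 = q" and v: "s mod q + v + 1 = q"
      unfolding u_def v_def using d(2,4) by linarith+
    then have "q * q = (s div q + u + 1) * q" by simp
    then have "q^2 = s div q * q + u * q + q" by (simp only: power2_eq_square distrib_right mult_1)
    moreover have "s = s div q * q + s mod q" by (rule div_mult_mod_eq[symmetric])
    ultimately have "q^2 - 1 - s = u * q + v" using v by linarith
    then show ?thesis by (simp only: u_def v_def)
  qed
  have td: "?t div q = q - 1 - s div q" "?t mod q = q - 1 - s mod q"
    unfolding t using q_pos by (simp_all add: div_add1_eq)
  have "(C_mat p m c a \<gamma> * back_identity_mat (q^2)) $$ (r, s)
      = (\<Sum>k<q^2. C_mat p m c a \<gamma> $$ (r, k) * back_identity_mat (q^2) $$ (k, s))"
    using r s car by (auto simp: scalar_prod_def back_identity_mat_def lessThan_atLeast0 intro!: sum.cong)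
  also have "\<dots> = (\<Sum>k<q^2. if k = ?t then C_mat p m c a \<gamma> $$ (r, k) else 0)"
    using s by (intro sum.cong) (auto simp: back_identity_mat_def)
  also have "\<dots> = C_mat p m c a \<gamma> $$ (r, ?t)" using s by simp
  also have "\<dots> = phi p c (a * (- e (r div q) + e (?t div q)) + \<gamma>) $$ (r mod q, ?t mod q)"
    using r s by (simp add: C_mat_def)
  also have "\<dots> = of_bool (centre + centre - e (s mod q) =
      e (r mod q) + (a * (- e (r div q) + (centre + centre - e (s div q))) + \<gamma>))"
    unfolding td phi_index[OF d(3) d5] e_reversed[OF d(2)] e_reversed[OF d(4)] by (simp only: of_bool_def)
  also have "centre + centre - e (s mod q) =
      e (r mod q) + (a * (- e (r div q) + (centre + centre - e (s div q))) + \<gamma>) \<longleftrightarrow>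
    centre + centre - e (s mod q) - e (r mod q) - a * (- e (r div q) + (centre + centre - e (s div q))) = \<gamma>"
    by (rule eq_add_add_iff)
  also have "centre + centre - e (s mod q) - e (r mod q) - a * (- e (r div q) + (centre + centre - e (s div q)))
    = a * ((e (r div q) - centre) + (e (s div q) - centre)) - (e (r mod q) - centre) - (e (s mod q) - centre)"
    by (simp only: algebra_simps mult_minus_right) simp
  finally show ?thesis .
qed

lemma A1_eq_kernel_mat: "A1 p m c L \<gamma> = kernel_mat (\<lambda>(b, B, Y) (b', B', Y').
  of_bool (b \<noteq> b' \<and> label b b' * (B + B') - Y - Y' = \<gamma>))"
proof (rule kernel_mat_eqI)
  let ?CR = "\<lambda>a. C_mat p m c a \<gamma> * back_identity_mat (q^2)"
  let ?S = "matsum N (\<lambda>a. P_mat L (Some a) \<otimes>\<^sub>m ?CR a) UNIV"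
  let ?D = "1\<^sub>m (q + 1) \<otimes>\<^sub>m (all_ones_mat (q^2) - 1\<^sub>m q \<otimes>\<^sub>m all_ones_mat q)"
  have dim: "dim_row (?CR a) = q^2" "dim_col (?CR a) = q^2" for a
    by (simp_all add: C_mat_def back_identity_mat_def)
  have Pdim: "dim_row (P_mat L x) = q + 1" "dim_col (P_mat L x) = q + 1" for x
    by (simp_all add: P_mat_def L_dim)
  have car: "(\<lambda>a. P_mat L (Some a) \<otimes>\<^sub>m ?CR a) \<in> UNIV \<rightarrow> carrier_mat N N"
    by (intro Pi_I) (simp only: carrier_mat_def mem_Collect_eq dim_kronecker dim Pdim N_def)
  have S: "?S \<in> carrier_mat N N" by (rule matsum_carrier[OF car])
  have D: "?D \<in> carrier_mat N N"
    unfolding A2_def[symmetric] A2_eq_kernel_mat by (rule kernel_mat_carrier)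
  have "A1 p m c L \<gamma> = ?D + ?S - ?D"
    by (simp only: A1_def N_mat_def Let_def card_q N_def)
  also have "\<dots> = ?S" using S D by (intro eq_matI) auto
  finally have A1: "A1 p m c L \<gamma> = ?S" .
  show "A1 p m c L \<gamma> \<in> carrier_mat N N" unfolding A1 by (rule S)
  fix i j assume ij: "i < N" "j < N"
  let ?b = "i div q^2" and ?b' = "j div q^2" and ?r = "i mod q^2" and ?s = "j mod q^2"
  have b: "?b \<le> q" "?b' \<le> q" using ij[THEN block_less] by simp_all
  have rs: "?r < q^2" "?s < q^2" using q_pos by simp_all
  let ?T = "\<lambda>a. a * ((e (i div q mod q) - centre) + (e (j div q mod q) - centre))
      - (e (i mod q) - centre) - (e (j mod q) - centre) = \<gamma>"
  have "A1 p m c L \<gamma> $$ (i, j) = (\<Sum>a\<in>UNIV. (P_mat L (Some a) \<otimes>\<^sub>m ?CR a) $$ (i, j))"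
    unfolding A1 by (rule index_matsum[OF car ij])
  also have "\<dots> = (\<Sum>a\<in>UNIV. P_mat L (Some a) $$ (?b, ?b') * ?CR a $$ (?r, ?s))"
    using ij by (subst index_kronecker) (simp_all only: dim Pdim N_def)
  also have "\<dots> = (\<Sum>a\<in>UNIV. of_bool (L $$ (?b, ?b') = Some a) * of_bool (?T a))"
    unfolding C_reversed_index[OF rs] mod_q2_div mod_q2_mod
    using b by (simp add: P_mat_def L_dim of_bool_def)
  also have "\<dots> = of_bool (?b \<noteq> ?b' \<and> ?T (label ?b ?b'))"
  proof (cases "?b = ?b'")
    case True
    then show ?thesis using L_diag[OF b(2)] by simp
  next
    case False
    have "(\<Sum>a\<in>UNIV. of_bool (L $$ (?b, ?b') = Some a) * of_bool (?T a) :: complex)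
        = (\<Sum>a\<in>UNIV. if a = label ?b ?b' then of_bool (?T a) else 0)"
      using L_label[OF b False] by (intro sum.cong) auto
    also have "\<dots> = of_bool (?T (label ?b ?b'))" by simp
    finally show ?thesis using False by simp
  qed
  finally show "A1 p m c L \<gamma> $$ (i, j) = (case point i of (b, B, Y) \<Rightarrow> \<lambda>(b', B', Y').
      of_bool (b \<noteq> b' \<and> label b b' * (B + B') - Y - Y' = \<gamma>)) (point j)"
    by (simp add: point_def)
qed

section \<open>Products of character sums\<close>

abbreviation r :: complex where "r \<equiv> of_nat q"

lemma q_gt_1: "q > 1"
proof -
  have "card {0, 1 :: 'a} \<le> CARD('a)" by (rule card_mono) auto
  then show ?thesis by simp
qed

lemma r_nz: "r \<noteq> 0" "r + 1 \<noteq> 0" "r \<noteq> 1"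
proof -
  show "r \<noteq> 0" using q_pos by simp
  have "of_nat (q + 1) \<noteq> (0 :: complex)" by (simp only: of_nat_eq_0_iff)
  then show "r + 1 \<noteq> 0" by (simp add: add.commute)
  have "of_nat q \<noteq> (of_nat 1 :: complex)" using q_gt_1 by (simp only: of_nat_eq_iff)
  then show "r \<noteq> 1" by simp
qed

lemma of_nat_N: "of_nat N = (r + 1) * r^2"
  by (simp add: N_def algebra_simps)

text \<open>The Fourier transforms, over the parameter \<open>\<gamma>\<close>, of the kernels of the two families
  \<open>A\<^bsub>\<gamma>,0\<^esub>\<close> and \<open>A\<^bsub>\<gamma>,1\<^esub>\<close>.\<close>
definition F0_kernel :: "'a \<Rightarrow> nat \<times> 'a \<times> 'a \<Rightarrow> nat \<times> 'a \<times> 'a \<Rightarrow> complex" where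
  "F0_kernel \<alpha> = (\<lambda>(b, B, Y) (b', B', Y'). of_bool (b = b' \<and> B = B') * \<chi> \<alpha> (Y' - Y))"

definition F1_kernel :: "'a \<Rightarrow> nat \<times> 'a \<times> 'a \<Rightarrow> nat \<times> 'a \<times> 'a \<Rightarrow> complex" where
  "F1_kernel \<alpha> = (\<lambda>(b, B, Y) (b', B', Y'). of_bool (b \<noteq> b') * \<chi> \<alpha> (label b b' * (B + B') - Y - Y'))"

lemma sum_indicator_at: "(\<Sum>\<gamma>\<in>UNIV. f \<gamma> * of_bool (P \<and> t = \<gamma>)) = of_bool P * (f t :: complex)"
  for t :: 'a
proof -
  have "(\<Sum>\<gamma>\<in>UNIV. f \<gamma> * of_bool (P \<and> t = \<gamma>)) = (\<Sum>\<gamma>\<in>UNIV. if \<gamma> = t then of_bool P * f t else 0)"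
    by (intro sum.cong) auto
  then show ?thesis by simp
qed

lemma F0_eq_kernel_mat: "F0 p c \<alpha> = kernel_mat (F0_kernel \<alpha>)"
proof -
  have "F0 p c \<alpha> = matsum N (\<lambda>\<gamma>. \<chi> \<alpha> \<gamma> \<cdot>\<^sub>m A0 p c \<gamma>) UNIV"
    by (simp only: F0_def character_sum_def card_q N_def)
  also have "\<dots> = kernel_mat (F0_kernel \<alpha>)"
    unfolding A0_eq_kernel_mat kernel_mat_smult kernel_mat_matsum[OF finite_class.finite_UNIV]
    by (rule kernel_mat_cong)
      (simp add: F0_kernel_def split_def sum_indicator_at[where P = "P1 \<and> P2" for P1 P2, unfolded conj_assoc])
  finally show ?thesis .
qed

lemma F1_eq_kernel_mat: "F1 p m c L \<alpha> = kernel_mat (F1_kernel \<alpha>)"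
proof -
  have "F1 p m c L \<alpha> = matsum N (\<lambda>\<gamma>. \<chi> \<alpha> \<gamma> \<cdot>\<^sub>m A1 p m c L \<gamma>) UNIV"
    by (simp only: F1_def character_sum_def card_q N_def)
  also have "\<dots> = kernel_mat (F1_kernel \<alpha>)"
    unfolding A1_eq_kernel_mat kernel_mat_smult kernel_mat_matsum[OF finite_class.finite_UNIV]
    by (rule kernel_mat_cong) (simp add: F1_kernel_def split_def sum_indicator_at)
  finally show ?thesis .
qed

text \<open>The sum over the innermost coordinate of every product below has this form: it is a character
  sum of \<open>\<alpha> + \<beta>\<close>, and the surviving terms no longer depend on the summation variable.\<close>
lemma sum_chi_convolution: "(\<Sum>y\<in>UNIV. \<chi> \<alpha> (d - y) * \<chi> \<beta> (d' - y)) = (if \<alpha> + \<beta> = 0 then r * \<chi> \<alpha> (d - d') else 0)"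
proof -
  have "(\<Sum>y\<in>UNIV. \<chi> \<alpha> (d - y) * \<chi> \<beta> (d' - y))
      = \<chi> \<alpha> d * \<chi> \<beta> d' * (\<Sum>y\<in>UNIV. \<chi> (\<alpha> + \<beta>) (- y))"
    unfolding sum_distrib_left
    by (intro sum.cong refl) (simp add: chi_diff chi_minus chi_add_left divide_inverse)
  also have "\<dots> = (if \<alpha> + \<beta> = 0 then r * (\<chi> \<alpha> d * \<chi> \<beta> d') else 0)"
    unfolding sum_chi_minus by simp
  finally have "(\<Sum>y\<in>UNIV. \<chi> \<alpha> (d - y) * \<chi> \<beta> (d' - y)) = \<dots>" .
  moreover have "\<beta> = - \<alpha>" if "\<alpha> + \<beta> = 0"
    using that by (simp add: eq_neg_iff_add_eq_0 add.commute)
  ultimately show ?thesis by (auto simp: chi_diff chi_minus divide_inverse)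
qed

lemma sum_point_fibre:
  assumes "b \<le> q"
  shows "(\<Sum>(b', B', Y')\<in>points. of_bool (b = b' \<and> B = B') * g b' B' Y') = (\<Sum>Y\<in>UNIV. g b B Y :: complex)"
proof -
  have "(\<Sum>B'\<in>UNIV. \<Sum>Y'\<in>UNIV. of_bool (b = b' \<and> B = B') * g b' B' Y')
      = (if b' = b then \<Sum>Y'\<in>UNIV. g b B Y' else 0)" for b'
  proof -
    have "(\<Sum>B'\<in>UNIV. \<Sum>Y'\<in>UNIV. of_bool (b = b' \<and> B = B') * g b' B' Y')
        = (\<Sum>B'\<in>UNIV. if B' = B then of_bool (b = b') * (\<Sum>Y'\<in>UNIV. g b' B Y') else 0)"
      by (rule sum.cong) (simp_all add: sum_distrib_left)
    then show ?thesis by simp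
  qed
  then have "(\<Sum>(b', B', Y')\<in>points. of_bool (b = b' \<and> B = B') * g b' B' Y')
      = (\<Sum>b'\<le>q. if b' = b then \<Sum>Y'\<in>UNIV. g b B Y' else 0)"
    unfolding sum_points by (simp only: prod.case)
  then show ?thesis using assms by simp
qed

lemma F0_kernel_mult:
  "kernel_mat (F0_kernel \<alpha>) * kernel_mat g = kernel_mat (\<lambda>(b, B, Y) z. \<Sum>Y'\<in>UNIV. \<chi> \<alpha> (Y' - Y) * g (b, B, Y') z)"
  unfolding kernel_mat_mult
proof (rule kernel_mat_cong)
  fix x z :: "nat \<times> 'a \<times> 'a" assume "x \<in> points"
  then obtain b B Y where x: "x = (b, B, Y)" "b \<le> q" by (cases x) auto
  have "(\<Sum>y\<in>points. F0_kernel \<alpha> x y * g y z) = (\<Sum>(b', B', Y')\<in>points.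
      of_bool (b = b' \<and> B = B') * (\<chi> \<alpha> (Y' - Y) * g (b', B', Y') z))"
    by (intro sum.cong) (auto simp: F0_kernel_def x)
  then show "(\<Sum>y\<in>points. F0_kernel \<alpha> x y * g y z)
      = (case x of (b, B, Y) \<Rightarrow> \<lambda>z. \<Sum>Y'\<in>UNIV. \<chi> \<alpha> (Y' - Y) * g (b, B, Y') z) z"
    unfolding sum_point_fibre[OF x(2)] by (simp add: x)
qed

lemma mult_F0_kernel:
  "kernel_mat g * kernel_mat (F0_kernel \<beta>) = kernel_mat (\<lambda>x (b, B, Y). \<Sum>Y'\<in>UNIV. g x (b, B, Y') * \<chi> \<beta> (Y - Y'))"
  unfolding kernel_mat_mult
proof (rule kernel_mat_cong)
  fix x z :: "nat \<times> 'a \<times> 'a" assume "z \<in> points"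
  then obtain b B Y where z: "z = (b, B, Y)" "b \<le> q" by (cases z) auto
  have "(\<Sum>y\<in>points. g x y * F0_kernel \<beta> y z) = (\<Sum>(b', B', Y')\<in>points.
      of_bool (b = b' \<and> B = B') * (g x (b', B', Y') * \<chi> \<beta> (Y - Y')))"
    by (intro sum.cong) (auto simp: F0_kernel_def z)
  then show "(\<Sum>y\<in>points. g x y * F0_kernel \<beta> y z)
      = (case z of (b, B, Y) \<Rightarrow> \<Sum>Y'\<in>UNIV. g x (b, B, Y') * \<chi> \<beta> (Y - Y'))"
    unfolding sum_point_fibre[OF z(2)] by (simp add: z)
qed

lemma chi_diff_swap: "\<chi> \<alpha> (y - d) = \<chi> (- \<alpha>) (d - y)"
  by (simp add: chi_diff chi_minus divide_inverse)

lemma F0_mult_F0: "F0 p c \<alpha> * F0 p c \<beta> = (if \<alpha> = \<beta> then r \<cdot>\<^sub>m F0 p c \<alpha> else 0\<^sub>m N N)"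
proof -
  have "(\<Sum>Y'\<in>UNIV. \<chi> \<alpha> (Y' - Y) * F0_kernel \<beta> (b, B, Y') (b', B', Y''))
      = (if \<alpha> = \<beta> then r * F0_kernel \<alpha> (b, B, Y) (b', B', Y'') else 0)" for b B Y b' B' Y''
  proof -
    have "(\<Sum>Y'\<in>UNIV. \<chi> \<alpha> (Y' - Y) * F0_kernel \<beta> (b, B, Y') (b', B', Y''))
        = of_bool (b = b' \<and> B = B') * (\<Sum>Y'\<in>UNIV. \<chi> (- \<alpha>) (Y - Y') * \<chi> \<beta> (Y'' - Y'))"
      unfolding sum_distrib_left by (intro sum.cong) (simp_all add: F0_kernel_def chi_diff_swap[of \<alpha>])
    then show ?thesis unfolding sum_chi_convolution by (auto simp: F0_kernel_def chi_diff_swap[of _ Y'' Y])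
  qed
  then show ?thesis
    unfolding F0_eq_kernel_mat F0_kernel_mult by (auto simp: kernel_mat_smult kernel_mat_zero split_def intro!: kernel_mat_cong)
qed

lemma F0_mult_F1: "F0 p c \<alpha> * F1 p m c L \<beta> = (if \<alpha> = \<beta> then r \<cdot>\<^sub>m F1 p m c L \<beta> else 0\<^sub>m N N)"
proof -
  have "(\<Sum>Y'\<in>UNIV. \<chi> \<alpha> (Y' - Y) * F1_kernel \<beta> (b, B, Y') (b', B', Y''))
      = (if \<alpha> = \<beta> then r * F1_kernel \<alpha> (b, B, Y) (b', B', Y'') else 0)" for b B Y b' B' Y''
  proof -
    have "(\<Sum>Y'\<in>UNIV. \<chi> \<alpha> (Y' - Y) * F1_kernel \<beta> (b, B, Y') (b', B', Y''))
        = of_bool (b \<noteq> b') * (\<Sum>Y'\<in>UNIV. \<chi> (- \<alpha>) (Y - Y') * \<chi> \<beta> (label b b' * (B + B') - Y'' - Y'))"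
      unfolding sum_distrib_left
      by (intro sum.cong) (simp_all add: F1_kernel_def chi_minus chi_diff divide_inverse mult_ac)
    then show ?thesis unfolding sum_chi_convolution
      by (auto simp: F1_kernel_def chi_minus chi_diff divide_inverse mult_ac)
  qed
  then show ?thesis
    unfolding F0_eq_kernel_mat F1_eq_kernel_mat F0_kernel_mult by (auto simp: kernel_mat_smult kernel_mat_zero split_def intro!: kernel_mat_cong)
qed

lemma F1_mult_F0: "F1 p m c L \<alpha> * F0 p c \<beta> = (if \<alpha> = - \<beta> then r \<cdot>\<^sub>m F1 p m c L \<alpha> else 0\<^sub>m N N)"
proof -
  have "(\<Sum>Y'\<in>UNIV. F1_kernel \<alpha> (b, B, Y) (b', B', Y') * \<chi> \<beta> (Y'' - Y'))
      = (if \<alpha> = - \<beta> then r * F1_kernel \<alpha> (b, B, Y) (b', B', Y'') else 0)" for b B Y b' B' Y''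
  proof -
    have "(\<Sum>Y'\<in>UNIV. F1_kernel \<alpha> (b, B, Y) (b', B', Y') * \<chi> \<beta> (Y'' - Y'))
        = of_bool (b \<noteq> b') * (\<Sum>Y'\<in>UNIV. \<chi> \<alpha> (label b b' * (B + B') - Y - Y') * \<chi> \<beta> (Y'' - Y'))"
      unfolding sum_distrib_left by (intro sum.cong) (simp_all add: F1_kernel_def)
    then show ?thesis unfolding sum_chi_convolution by (auto simp: F1_kernel_def eq_neg_iff_add_eq_0)
  qed
  then show ?thesis
    unfolding F0_eq_kernel_mat F1_eq_kernel_mat mult_F0_kernel by (auto simp: kernel_mat_smult kernel_mat_zero split_def intro!: kernel_mat_cong)
qed

text \<open>The contribution of one intermediate block. The sum over \<open>Y'\<close> forces \<open>\<alpha> = - \<beta>\<close>. The sum over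
  \<open>B'\<close> then forces the labels of \<open>(b, b')\<close> and \<open>(b', b'')\<close> to agree, which by the Latin property of row
  \<open>b'\<close> means \<open>b = b''\<close>.\<close>
lemma F1_kernel_product_block:
  assumes "b \<le> q" "b' \<le> q" "b'' \<le> q" and "\<alpha> \<noteq> 0"
  shows "(\<Sum>B'\<in>UNIV. \<Sum>Y'\<in>UNIV. F1_kernel \<alpha> (b, B, Y) (b', B', Y') * F1_kernel \<beta> (b', B', Y') (b'', B'', Y''))
    = (if \<alpha> = - \<beta> \<and> b = b'' \<and> b \<noteq> b' then r^2 * \<chi> \<alpha> (Y'' - Y) * \<chi> \<alpha> ((B - B'') * label b b') else 0)"
proof -
  let ?l = "label b b'" and ?l' = "label b' b''"
  have "(\<Sum>Y'\<in>UNIV. F1_kernel \<alpha> (b, B, Y) (b', B', Y') * F1_kernel \<beta> (b', B', Y') (b'', B'', Y''))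
      = of_bool (\<alpha> = - \<beta> \<and> b \<noteq> b' \<and> b' \<noteq> b'') * r * \<chi> \<alpha> (?l * B - ?l' * B'' + (Y'' - Y)) * \<chi> \<alpha> ((?l - ?l') * B')"
    for B'
  proof -
    have "(\<Sum>Y'\<in>UNIV. F1_kernel \<alpha> (b, B, Y) (b', B', Y') * F1_kernel \<beta> (b', B', Y') (b'', B'', Y''))
        = of_bool (b \<noteq> b' \<and> b' \<noteq> b'') * (\<Sum>Y'\<in>UNIV. \<chi> \<alpha> (?l * (B + B') - Y - Y') * \<chi> \<beta> (?l' * (B' + B'') - Y'' - Y'))"
      unfolding sum_distrib_left by (intro sum.cong) (auto simp: F1_kernel_def chi_diff divide_inverse mult_ac)
    also have "\<dots> = of_bool (b \<noteq> b' \<and> b' \<noteq> b'') * (if \<alpha> + \<beta> = 0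
        then r * \<chi> \<alpha> ((?l * B - ?l' * B'' + (Y'' - Y)) + (?l - ?l') * B') else 0)"
    proof -
      have "?l * (B + B') - Y - (?l' * (B' + B'') - Y'')
          = (?l * B - ?l' * B'' + (Y'' - Y)) + (?l - ?l') * B'"
        by (simp add: algebra_simps)
      then show ?thesis unfolding sum_chi_convolution by (simp only:)
    qed
    also have "\<dots> = of_bool (\<alpha> = - \<beta> \<and> b \<noteq> b' \<and> b' \<noteq> b'') * r
        * \<chi> \<alpha> (?l * B - ?l' * B'' + (Y'' - Y)) * \<chi> \<alpha> ((?l - ?l') * B')"
      unfolding chi_add[of _ _ "(?l - ?l') * B'"] eq_neg_iff_add_eq_0 by auto
    finally show ?thesis .
  qed
  then have "(\<Sum>B'\<in>UNIV. \<Sum>Y'\<in>UNIV. F1_kernel \<alpha> (b, B, Y) (b', B', Y') * F1_kernel \<beta> (b', B', Y') (b'', B'', Y''))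
      = of_bool (\<alpha> = - \<beta> \<and> b \<noteq> b' \<and> b' \<noteq> b'') * r * \<chi> \<alpha> (?l * B - ?l' * B'' + (Y'' - Y))
        * (if ?l = ?l' then r else 0)"
    using sum_chi_mult[OF \<open>\<alpha> \<noteq> 0\<close>, of "?l - ?l'"] by (simp only: sum_distrib_left[symmetric]) simp
  moreover have "?l = ?l' \<longleftrightarrow> b = b''" if "b \<noteq> b'" "b' \<noteq> b''"
    using label_inj[of b' b b''] assms that by (simp add: label_sym[of b b'])
  moreover have "?l = ?l'" if "b = b''"
    using label_sym[OF assms(1,2)] that by simp
  moreover have "?l * B - ?l * B'' + (Y'' - Y) = (Y'' - Y) + (B - B'') * ?l"
    by (simp add: algebra_simps)
  ultimately show ?thesis by (auto simp: chi_add power2_eq_square)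
qed

text \<open>As the intermediate block runs through all blocks other than \<open>b\<close>, its label runs through the
  whole field once. The remaining sum is a full character sum at \<open>B - B''\<close>, and it forces \<open>B = B''\<close>.\<close>
lemma F1_mult_F1:
  assumes "\<alpha> \<noteq> 0"
  shows "F1 p m c L \<alpha> * F1 p m c L \<beta> = (if \<alpha> = - \<beta> then r^3 \<cdot>\<^sub>m F0 p c \<alpha> else 0\<^sub>m N N)"
proof -
  have "(\<Sum>y\<in>points. F1_kernel \<alpha> (b, B, Y) y * F1_kernel \<beta> y (b'', B'', Y''))
      = (if \<alpha> = - \<beta> then r^3 * F0_kernel \<alpha> (b, B, Y) (b'', B'', Y'') else 0)"
    if b: "b \<le> q" "b'' \<le> q" for b B Y b'' B'' Y''
  proof -
    have "(\<Sum>y\<in>points. F1_kernel \<alpha> (b, B, Y) y * F1_kernel \<beta> y (b'', B'', Y''))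
      = (\<Sum>b'\<le>q. if \<alpha> = - \<beta> \<and> b = b'' \<and> b \<noteq> b'
          then r^2 * \<chi> \<alpha> (Y'' - Y) * \<chi> \<alpha> ((B - B'') * label b b') else 0)"
      unfolding sum_points using b assms by (intro sum.cong refl F1_kernel_product_block) auto
    also have "\<dots> = of_bool (\<alpha> = - \<beta> \<and> b = b'') * r^2 * \<chi> \<alpha> (Y'' - Y)
        * (\<Sum>b'\<in>{..q} - {b}. \<chi> \<alpha> ((B - B'') * label b b'))"
      unfolding sum_distrib_left by (rule sum.mono_neutral_cong_right) auto
    also have "(\<Sum>b'\<in>{..q} - {b}. \<chi> \<alpha> ((B - B'') * label b b')) = (\<Sum>a\<in>UNIV. \<chi> \<alpha> ((B - B'') * a))"
      by (rule sum.reindex_bij_betw[OF label_bij[OF b(1)]])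
    also have "\<dots> = (if B = B'' then r else 0)" using sum_chi_mult[OF assms] by simp
    finally show ?thesis by (auto simp: F0_kernel_def power2_eq_square power3_eq_cube)
  qed
  then show ?thesis
    unfolding F0_eq_kernel_mat F1_eq_kernel_mat kernel_mat_mult by (auto simp: kernel_mat_smult kernel_mat_zero intro!: kernel_mat_cong)
qed

lemma F0_adjoint: "mat_adjoint (F0 p c \<alpha>) = F0 p c \<alpha>"
  unfolding F0_eq_kernel_mat kernel_mat_adjoint
  by (rule kernel_mat_cong) (auto simp: F0_kernel_def cnj_chi chi_diff divide_inverse mult_ac)

text \<open>Both the symmetry of the Latin square and the symmetry of the kernel in the two points enter
  here; conjugation replaces the character by its inverse.\<close>
lemma F1_adjoint: "mat_adjoint (F1 p m c L \<alpha>) = F1 p m c L (- \<alpha>)"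
  unfolding F1_eq_kernel_mat kernel_mat_adjoint
  by (rule kernel_mat_cong) (auto simp: F1_kernel_def cnj_chi chi_minus chi_diff label_sym add.commute divide_inverse mult_ac)

section \<open>The trivial character\<close>

definition block :: "nat \<times> 'a \<times> 'a \<Rightarrow> nat \<times> 'a \<times> 'a \<Rightarrow> complex" where
  "block x y = of_bool (fst x = fst y)"

definition fibre :: "nat \<times> 'a \<times> 'a \<Rightarrow> nat \<times> 'a \<times> 'a \<Rightarrow> complex" where
  "fibre x y = of_bool (fst x = fst y \<and> fst (snd x) = fst (snd y))"

text \<open>The span of \<open>J\<close>, \<open>I \<otimes> J\<^bsub>q\<^sup>2\<^esub>\<close> and \<open>I \<otimes> J\<^bsub>q\<^esub>\<close>, which contains \<open>A\<^sub>2\<close> and everything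
  belonging to the trivial character. It is closed under multiplication.\<close>
definition coarse :: "complex \<Rightarrow> complex \<Rightarrow> complex \<Rightarrow> complex mat" where
  "coarse a b d = kernel_mat (\<lambda>x y. a + b * block x y + d * fibre x y)"

lemma sum_one: "(\<Sum>y\<in>points. 1 :: complex) = of_nat N"
  using bij_betw_same_card[OF point_bij] by simp

lemma sum_block: "x \<in> points \<Longrightarrow> (\<Sum>y\<in>points. block x y) = r^2"
proof -
  assume "x \<in> points"
  have "(\<Sum>y\<in>points. block x y) = (\<Sum>b\<le>q. if b = fst x then r^2 else 0)"
    unfolding sum_points block_def by (intro sum.cong) (auto simp: power2_eq_square)
  also have "\<dots> = r^2" using \<open>x \<in> points\<close> by auto
  finally show ?thesis .
qed

lemma sum_fibre: "x \<in> points \<Longrightarrow> (\<Sum>y\<in>points. fibre x y) = r"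
proof -
  assume "x \<in> points"
  then have "fst x \<le> q" by auto
  have "(\<Sum>y\<in>points. fibre x y)
      = (\<Sum>(b', B', Y')\<in>points. of_bool (fst x = b' \<and> fst (snd x) = B') * 1)"
    by (intro sum.cong) (auto simp: fibre_def)
  also have "\<dots> = r" unfolding sum_point_fibre[OF \<open>fst x \<le> q\<close>] by simp
  finally show ?thesis .
qed

text \<open>Blocks and fibres are equivalence classes, so every product of two indicators equals an
  indicator of the outer points times one that involves the summation point. Only class sizes
  remain to be summed.\<close>
lemma coarse_mult: "coarse a b d * coarse a' b' d'
  = coarse (of_nat N * a * a' + r^2 * (a * b' + b * a') + r * (a * d' + d * a'))
    (r^2 * b * b' + r * (b * d' + d * b')) (r * d * d')"
  unfolding coarse_def kernel_mat_mult
proof (rule kernel_mat_cong)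
  fix x z :: "nat \<times> 'a \<times> 'a" assume xz: "x \<in> points" "z \<in> points"
  \<comment> \<open>All indicators of \<open>y\<close> are moved into the forms \<open>block x y\<close>, \<open>fibre x y\<close>, \<open>block z y\<close>, \<open>fibre z y\<close>.\<close>
  have "(a + b * block x y + d * fibre x y) * (a' + b' * block y z + d' * fibre y z)
    = a * a' + (b * a' + b * b' * block x z) * block x y + (d * a' + d * b' * block x z + d * d' * fibre x z) * fibre x y
      + a * b' * block z y + (a * d' + b * d' * block x z) * fibre z y" for y
    by (auto simp: block_def fibre_def algebra_simps)
  then show "(\<Sum>y\<in>points. (a + b * block x y + d * fibre x y) * (a' + b' * block y z + d' * fibre y z))
    = of_nat N * a * a' + r^2 * (a * b' + b * a') + r * (a * d' + d * a')
      + (r^2 * b * b' + r * (b * d' + d * b')) * block x z + r * d * d' * fibre x z"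
    using sum_one by (simp only: sum.distrib sum_distrib_left[symmetric] sum_block[OF xz(1)] sum_block[OF xz(2)]
      sum_fibre[OF xz(1)] sum_fibre[OF xz(2)]) (simp add: algebra_simps)
qed

lemma coarse_linear:
  "r' \<cdot>\<^sub>m coarse a b d = coarse (r' * a) (r' * b) (r' * d)"
  "coarse a b d + coarse a' b' d' = coarse (a + a') (b + b') (d + d')"
  "coarse a b d - coarse a' b' d' = coarse (a - a') (b - b') (d - d')"
  unfolding coarse_def kernel_mat_smult kernel_mat_add kernel_mat_diff by (simp_all add: algebra_simps)

lemma coarse_generators:
  "all_ones_mat N = coarse 1 0 0" "F0 p c 0 = coarse 0 0 1"
  "F1 p m c L 0 = coarse 1 (- 1) 0" "A2 q = coarse 0 1 (- 1)"
  unfolding all_ones_eq_kernel_mat F0_eq_kernel_mat F1_eq_kernel_mat A2_eq_kernel_mat coarse_def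
  by (auto intro!: kernel_mat_cong simp: F0_kernel_def F1_kernel_def block_def fibre_def)

lemma coarse_zero: "0\<^sub>m N N = coarse 0 0 0"
  by (simp add: coarse_def kernel_mat_zero)

text \<open>As operators on functions of \<open>(b, B, Y)\<close>, these are the orthogonal projections onto the
  constants, onto the functions of \<open>(b, B)\<close> with sum zero in each block, and onto the functions of
  \<open>b\<close> with sum zero.\<close>
lemma E_one_coarse:
  "E_one p m c L 0 = coarse (1 / ((r + 1) * r^2)) 0 0"
  "E_one p m c L (Suc 0) = coarse 0 (- 1 / r^2) (1 / r)"
  "E_one p m c L 2 = coarse (- 1 / ((r + 1) * r^2)) (1 / r^2) 0"
proof -
  have "r^2 - 1 - - (r + 1) = (r + 1) * r" by (simp add: algebra_simps power2_eq_square)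
  then have 1: "(1 / ((r + 1) * r^2)) * (- (r + 1)) = - 1 / r^2"
    "(1 / ((r + 1) * r^2)) * (r^2 - 1 - - (r + 1)) = 1 / r"
    "(1 / ((r + 1) * r^2)) * (r + 1) = 1 / r^2"
    using r_nz by (simp_all add: power2_eq_square del: minus_add_distrib)
  show "E_one p m c L 0 = coarse (1 / ((r + 1) * r^2)) 0 0"
    by (simp add: E_one_def Let_def N_def[simplified, symmetric] coarse_generators coarse_linear)
  show "E_one p m c L (Suc 0) = coarse 0 (- 1 / r^2) (1 / r)"
    unfolding 1[symmetric] by (simp add: E_one_def Let_def coarse_generators coarse_linear)
  show "E_one p m c L 2 = coarse (- 1 / ((r + 1) * r^2)) (1 / r^2) 0"
    unfolding 1[symmetric] by (simp add: E_one_def Let_def coarse_generators coarse_linear algebra_simps)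
qed

section \<open>Relations between the matrix units\<close>

lemma coarse_adjoint: "mat_adjoint (coarse a b d) = coarse (cnj a) (cnj b) (cnj d)"
  unfolding coarse_def kernel_mat_adjoint by (rule kernel_mat_cong) (auto simp: block_def fibre_def)

lemma E_one_mult:
  assumes "i \<in> {0, 1, 2}" and "i' \<in> {0, 1, 2}"
  shows "E_one p m c L i * E_one p m c L i' = (if i = i' then E_one p m c L i else 0\<^sub>m N N)"
proof -
  have eq: "coarse a b d = coarse a' b' d'" if "a = a'" "b = b'" "d = d'" for a b d a' b' d'
    using that by simp
  \<comment> \<open>The relations hold with any nonzero number \<open>s\<close> in place of \<open>r + 1\<close>.\<close>
  define s where "s = r + 1"
  have nz: "r \<noteq> 0" "s \<noteq> 0" using r_nz by (simp_all add: s_def)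
  show ?thesis
    using assms nz
    by (auto simp: E_one_coarse[folded s_def] coarse_mult coarse_zero of_nat_N[folded s_def]
        field_simps power2_eq_square intro!: eq)
qed

lemma E_one_adjoint: "i \<in> {0, 1, 2} \<Longrightarrow> mat_adjoint (E_one p m c L i) = E_one p m c L i"
  by (auto simp: E_one_coarse coarse_adjoint)

lemma coarse_nonzero: "a + b + d \<noteq> 0 \<Longrightarrow> coarse a b d \<noteq> 0\<^sub>m N N"
  unfolding coarse_def
  by (rule kernel_mat_nonzero[of "(0, 0, 0)" "(0, 0, 0)"]) (simp_all add: block_def fibre_def)

lemma E_one_nonzero:
  assumes "i \<in> {0, 1, 2}"
  shows "E_one p m c L i \<noteq> 0\<^sub>m N N"
proof -
  have "1 / ((r + 1) * r^2) \<noteq> 0" using r_nz by simp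
  moreover have "- 1 / r^2 + 1 / r \<noteq> 0"
    using r_nz by (simp add: field_simps power2_eq_square)
  moreover have "- 1 / ((r + 1) * r^2) + 1 / r^2 \<noteq> 0"
  proof -
    have "- 1 / (s * r^2) + 1 / r^2 = (s - 1) / (s * r^2)" if "s \<noteq> 0" for s
      using that r_nz by (simp add: field_simps)
    from this[of "r + 1"] r_nz show ?thesis by simp
  qed
  ultimately have "coarse (1 / ((r + 1) * r^2)) 0 0 \<noteq> 0\<^sub>m N N"
    "coarse 0 (- 1 / r^2) (1 / r) \<noteq> 0\<^sub>m N N"
    "coarse (- 1 / ((r + 1) * r^2)) (1 / r^2) 0 \<noteq> 0\<^sub>m N N"
    by (intro coarse_nonzero; simp only: add_0_left add_0_right)+
  then show ?thesis using assms by (auto simp only: E_one_coarse One_nat_def)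
qed

lemma F_carrier [simp]: "F0 p c \<alpha> \<in> carrier_mat N N" "F1 p m c L \<alpha> \<in> carrier_mat N N"
  by (simp_all add: F0_eq_kernel_mat F1_eq_kernel_mat)

lemma coarse_carrier [simp]: "coarse a b d \<in> carrier_mat N N"
  by (simp add: coarse_def)

text \<open>Up to a factor, \<open>F\<^bsub>0,0\<^esub>\<close> is the projection onto the functions that are constant on fibres, and it
  fixes all coarse matrices. Their orthogonality to the nontrivial characters thus reduces to
  that of \<open>F\<^bsub>0,0\<^esub>\<close>.\<close>
lemma coarse_factors_through_F0:
  "\<exists>a' b' c'. coarse a b d = coarse a' b' c' * F0 p c 0"
  "\<exists>a' b' c'. coarse a b d = F0 p c 0 * coarse a' b' c'"
proof -
  have "coarse a b d = coarse (a / r) (b / r) (d / r) * F0 p c 0"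
    "coarse a b d = F0 p c 0 * coarse (a / r) (b / r) (d / r)"
    using r_nz by (simp_all add: coarse_generators coarse_mult)
  then show "\<exists>a' b' c'. coarse a b d = coarse a' b' c' * F0 p c 0"
    "\<exists>a' b' c'. coarse a b d = F0 p c 0 * coarse a' b' c'" by blast+
qed

lemma coarse_orthogonal:
  assumes "\<alpha> \<noteq> 0"
  shows "coarse a b d * F0 p c \<alpha> = 0\<^sub>m N N" "coarse a b d * F1 p m c L \<alpha> = 0\<^sub>m N N"
    "F0 p c \<alpha> * coarse a b d = 0\<^sub>m N N" "F1 p m c L \<alpha> * coarse a b d = 0\<^sub>m N N"
proof -
  obtain a1 b1 c1 where 1: "coarse a b d = coarse a1 b1 c1 * F0 p c 0" using coarse_factors_through_F0 by blast
  obtain a2 b2 c2 where 2: "coarse a b d = F0 p c 0 * coarse a2 b2 c2" using coarse_factors_through_F0 by blast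
  show "coarse a b d * F0 p c \<alpha> = 0\<^sub>m N N" "coarse a b d * F1 p m c L \<alpha> = 0\<^sub>m N N"
    unfolding 1 using assms by (simp_all add: assoc_mult_mat[of _ N N _ N _ N] F0_mult_F0 F0_mult_F1 right_mult_zero_mat[of _ N N])
  show "F0 p c \<alpha> * coarse a b d = 0\<^sub>m N N" "F1 p m c L \<alpha> * coarse a b d = 0\<^sub>m N N"
    unfolding 2 using assms by (simp_all add: assoc_mult_mat[of _ N N _ N _ N, symmetric] F0_mult_F0 F1_mult_F0 left_mult_zero_mat[of _ N N])
qed

lemma smult_smult: "a \<cdot>\<^sub>m (b \<cdot>\<^sub>m A) = (a * b :: complex) \<cdot>\<^sub>m A"
  by (intro eq_matI) auto

lemma smult_mult:
  assumes "A \<in> carrier_mat N N" "B \<in> carrier_mat N N"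
  shows "(a \<cdot>\<^sub>m A) * (b \<cdot>\<^sub>m B) = (a * b :: complex) \<cdot>\<^sub>m (A * B)"
  using assms by (simp add: mult_smult_distrib[of _ N N _ N] mult_smult_assoc_mat[of _ N N _ N] smult_smult mult.commute)

lemma smult_zero: "a \<cdot>\<^sub>m 0\<^sub>m N N = (0\<^sub>m N N :: complex mat)"
  by (intro eq_matI) auto

lemma E_two_simps:
  "E_two p m c L \<alpha> 1 1 = (1 / r) \<cdot>\<^sub>m F0 p c \<alpha>"
  "E_two p m c L \<alpha> 2 2 = (1 / r) \<cdot>\<^sub>m F0 p c (- \<alpha>)"
  "E_two p m c L \<alpha> 1 2 = (1 / r^2) \<cdot>\<^sub>m F1 p m c L \<alpha>"
  "E_two p m c L \<alpha> 2 1 = (1 / r^2) \<cdot>\<^sub>m F1 p m c L (- \<alpha>)"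
  by (simp_all add: E_two_def Let_def)

lemma E_one_E_two_orthogonal:
  assumes "i \<in> {0, 1, 2}" and "\<alpha> \<noteq> 0" and "j \<in> {1, 2}" and "k \<in> {1, 2}"
  shows "E_one p m c L i * E_two p m c L \<alpha> j k = 0\<^sub>m N N"
    and "E_two p m c L \<alpha> j k * E_one p m c L i = 0\<^sub>m N N"
proof -
  obtain a b d where "E_one p m c L i = coarse a b d"
    using assms(1) by (auto simp: E_one_coarse)
  moreover obtain s F where "E_two p m c L \<alpha> j k = s \<cdot>\<^sub>m F" "F \<in> carrier_mat N N"
    "coarse a b d * F = 0\<^sub>m N N" "F * coarse a b d = 0\<^sub>m N N"
    using assms(2-) E_two_simps[of \<alpha>] coarse_orthogonal[of \<alpha> a b d] coarse_orthogonal[of "- \<alpha>" a b d]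
      F_carrier[of \<alpha>] F_carrier[of "- \<alpha>"] by (auto simp del: F_carrier One_nat_def)
  ultimately show "E_one p m c L i * E_two p m c L \<alpha> j k = 0\<^sub>m N N"
    "E_two p m c L \<alpha> j k * E_one p m c L i = 0\<^sub>m N N"
    by (simp_all add: mult_smult_distrib[of _ N N _ N] mult_smult_assoc_mat[of _ N N _ N] smult_zero)
qed

text \<open>The condition \<open>\<alpha> \<noteq> - \<beta>\<close> is what separates different components, since the component of \<open>\<alpha>\<close> uses
  the characters of both \<open>\<alpha>\<close> and \<open>- \<alpha>\<close>.\<close>
lemma E_two_mult:
  assumes "\<alpha> \<noteq> 0" "\<beta> \<noteq> 0" "\<alpha> \<noteq> - \<beta>"
    and "j \<in> {1, 2}" "k \<in> {1, 2}" "j' \<in> {1, 2}" "k' \<in> {1, 2}"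
  shows "E_two p m c L \<alpha> j k * E_two p m c L \<beta> j' k'
    = (if \<alpha> = \<beta> \<and> k = j' then E_two p m c L \<alpha> j k' else 0\<^sub>m N N)"
proof -
  have neg: "- \<alpha> \<noteq> \<beta>" "\<beta> \<noteq> - \<alpha>" using assms(3) by auto
  have nz: "- \<alpha> \<noteq> 0" using assms(1) by simp
  have P00: "(1 / r) \<cdot>\<^sub>m F0 p c x * ((1 / r) \<cdot>\<^sub>m F0 p c y)
      = (if x = y then (1 / r) \<cdot>\<^sub>m F0 p c x else 0\<^sub>m N N)" for x y
    using r_nz by (simp add: smult_mult F0_mult_F0 smult_smult smult_zero)
  have P01: "(1 / r) \<cdot>\<^sub>m F0 p c x * ((1 / r^2) \<cdot>\<^sub>m F1 p m c L y)
      = (if x = y then (1 / r^2) \<cdot>\<^sub>m F1 p m c L y else 0\<^sub>m N N)" for x y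
    using r_nz by (simp add: smult_mult F0_mult_F1 smult_smult smult_zero)
  have P10: "(1 / r^2) \<cdot>\<^sub>m F1 p m c L x * ((1 / r) \<cdot>\<^sub>m F0 p c y)
      = (if x = - y then (1 / r^2) \<cdot>\<^sub>m F1 p m c L x else 0\<^sub>m N N)" for x y
    using r_nz by (simp add: smult_mult F1_mult_F0 smult_smult smult_zero)
  have P11: "(1 / r^2) \<cdot>\<^sub>m F1 p m c L x * ((1 / r^2) \<cdot>\<^sub>m F1 p m c L y)
      = (if x = - y then (1 / r) \<cdot>\<^sub>m F0 p c x else 0\<^sub>m N N)" if "x \<noteq> 0" for x y
  proof -
    have "1 / r^2 * (1 / r^2) * r^3 = 1 / r"
      using r_nz by (simp add: field_simps power2_eq_square power3_eq_cube)
    then show ?thesis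
      by (simp only: smult_mult F_carrier F1_mult_F1[OF that] smult_smult smult_zero
          if_distrib[of "(\<cdot>\<^sub>m) (1 / r^2 * (1 / r^2))"])
  qed
  from assms(4-) show ?thesis
    using neg assms(1-3) nz
    by (elim insertE emptyE)
      (simp_all add: E_two_simps P00 P01 P10 P11 del: One_nat_def)
qed

lemma E_two_adjoint:
  assumes "j \<in> {1, 2}" "k \<in> {1, 2}"
  shows "mat_adjoint (E_two p m c L \<alpha> j k) = E_two p m c L \<alpha> k j"
proof -
  have adj: "mat_adjoint (s \<cdot>\<^sub>m kernel_mat f) = cnj s \<cdot>\<^sub>m mat_adjoint (kernel_mat f)" for s f
    by (simp add: kernel_mat_smult kernel_mat_adjoint)
  have *: "mat_adjoint ((1 / r) \<cdot>\<^sub>m F0 p c x) = (1 / r) \<cdot>\<^sub>m F0 p c x"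
    "mat_adjoint ((1 / r^2) \<cdot>\<^sub>m F1 p m c L x) = (1 / r^2) \<cdot>\<^sub>m F1 p m c L (- x)" for x
    using F0_adjoint[of x] F1_adjoint[of x] adj[of "1 / r"] adj[of "1 / r^2"]
    by (simp_all add: F0_eq_kernel_mat F1_eq_kernel_mat)
  from assms show ?thesis
    by (elim insertE emptyE) (simp_all add: E_two_simps * del: One_nat_def)
qed

lemma E_two_nonzero:
  assumes "j \<in> {1, 2}" "k \<in> {1, 2}"
  shows "E_two p m c L \<alpha> j k \<noteq> 0\<^sub>m N N"
proof -
  have "(1 / r) \<cdot>\<^sub>m F0 p c x \<noteq> 0\<^sub>m N N" for x
    unfolding F0_eq_kernel_mat kernel_mat_smult
    by (rule kernel_mat_nonzero[of "(0, 0, 0)" "(0, 0, 0)"]) (use r_nz in \<open>simp_all add: F0_kernel_def\<close>)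
  moreover have "(1 / r^2) \<cdot>\<^sub>m F1 p m c L x \<noteq> 0\<^sub>m N N" for x
    unfolding F1_eq_kernel_mat kernel_mat_smult
    by (rule kernel_mat_nonzero[of "(0, 0, 0)" "(1, 0, 0)"])
      (use r_nz q_gt_1 in \<open>simp_all add: F1_kernel_def\<close>)
  ultimately show ?thesis
    using assms by (elim insertE emptyE) (simp_all add: E_two_simps del: One_nat_def)
qed

lemma E_carrier:
  "i \<in> {0, 1, 2} \<Longrightarrow> E_one p m c L i \<in> carrier_mat N N"
  "j \<in> {1, 2} \<Longrightarrow> k \<in> {1, 2} \<Longrightarrow> E_two p m c L \<alpha> j k \<in> carrier_mat N N"
proof -
  show "E_one p m c L i \<in> carrier_mat N N" if "i \<in> {0, 1, 2}"
    using that by (auto simp: E_one_coarse)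
  show "E_two p m c L \<alpha> j k \<in> carrier_mat N N" if "j \<in> {1, 2}" "k \<in> {1, 2}"
    using that by (elim insertE emptyE) (simp_all add: E_two_simps del: One_nat_def)
qed

section \<open>The matrix units generate the algebra\<close>

text \<open>Fourier inversion over the parameter \<open>\<gamma>\<close> recovers the scheme from the character sums.\<close>
lemma A0_inversion:
  "A0 p c \<gamma> = (1 / r) \<cdot>\<^sub>m matsum N (\<lambda>\<alpha>. \<chi> \<alpha> (- \<gamma>) \<cdot>\<^sub>m F0 p c \<alpha>) UNIV"
proof -
  have "(\<Sum>\<alpha>\<in>UNIV. \<chi> \<alpha> (- \<gamma>) * F0_kernel \<alpha> (b, B, Y) (b', B', Y'))
      = r * of_bool (b = b' \<and> B = B' \<and> Y' - Y = \<gamma>)" for b B Y b' B' Y'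
  proof -
    have "(\<Sum>\<alpha>\<in>UNIV. \<chi> \<alpha> (- \<gamma>) * F0_kernel \<alpha> (b, B, Y) (b', B', Y'))
        = of_bool (b = b' \<and> B = B') * (\<Sum>\<alpha>\<in>UNIV. \<chi> \<alpha> (- \<gamma> + (Y' - Y)))"
      unfolding sum_distrib_left by (intro sum.cong) (simp_all add: F0_kernel_def chi_add[symmetric])
    then show ?thesis unfolding sum_chi_left by (auto simp: algebra_simps)
  qed
  then have "(case x of (b, B, Y) \<Rightarrow> \<lambda>(b', B', Y'). of_bool (b = b' \<and> B = B' \<and> Y' - Y = \<gamma>)) y
      = 1 / r * (\<Sum>\<alpha>\<in>UNIV. \<chi> \<alpha> (- \<gamma>) * F0_kernel \<alpha> x y)" for x y
    using r_nz by (cases x; cases y) simp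
  then show ?thesis
    unfolding A0_eq_kernel_mat F0_eq_kernel_mat kernel_mat_smult kernel_mat_matsum[OF finite_class.finite_UNIV]
    by (rule kernel_mat_cong)
qed

lemma A1_inversion:
  "A1 p m c L \<gamma> = (1 / r) \<cdot>\<^sub>m matsum N (\<lambda>\<alpha>. \<chi> \<alpha> (- \<gamma>) \<cdot>\<^sub>m F1 p m c L \<alpha>) UNIV"
proof -
  have "(\<Sum>\<alpha>\<in>UNIV. \<chi> \<alpha> (- \<gamma>) * F1_kernel \<alpha> (b, B, Y) (b', B', Y'))
      = r * of_bool (b \<noteq> b' \<and> label b b' * (B + B') - Y - Y' = \<gamma>)" for b B Y b' B' Y'
  proof -
    have "(\<Sum>\<alpha>\<in>UNIV. \<chi> \<alpha> (- \<gamma>) * F1_kernel \<alpha> (b, B, Y) (b', B', Y'))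
        = of_bool (b \<noteq> b') * (\<Sum>\<alpha>\<in>UNIV. \<chi> \<alpha> (- \<gamma> + (label b b' * (B + B') - Y - Y')))"
      unfolding sum_distrib_left by (intro sum.cong) (simp_all add: F1_kernel_def chi_add[symmetric])
    moreover have "- \<gamma> + t = 0 \<longleftrightarrow> t = \<gamma>" for t :: 'a by simp
    ultimately show ?thesis unfolding sum_chi_left by auto
  qed
  then have "(case x of (b, B, Y) \<Rightarrow> \<lambda>(b', B', Y'). of_bool (b \<noteq> b' \<and> label b b' * (B + B') - Y - Y' = \<gamma>)) y
      = 1 / r * (\<Sum>\<alpha>\<in>UNIV. \<chi> \<alpha> (- \<gamma>) * F1_kernel \<alpha> x y)" for x y
    using r_nz by (cases x; cases y) simp
  then show ?thesis
    unfolding A1_eq_kernel_mat F1_eq_kernel_mat kernel_mat_smult kernel_mat_matsum[OF finite_class.finite_UNIV]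
    by (rule kernel_mat_cong)
qed

lemma scheme_matrices_carrier: "scheme_matrices p m c L \<subseteq> carrier_mat N N"
  by (auto simp: scheme_matrices_def A0_eq_kernel_mat A1_eq_kernel_mat A2_eq_kernel_mat)

lemma matrix_units_in_algebra:
  shows "i \<in> {0, 1, 2} \<Longrightarrow> E_one p m c L i \<in> adjacency_algebra N (scheme_matrices p m c L)"
    and "j \<in> {1, 2} \<Longrightarrow> k \<in> {1, 2} \<Longrightarrow>
      E_two p m c L \<alpha> j k \<in> adjacency_algebra N (scheme_matrices p m c L)"
proof -
  let ?W = "adjacency_algebra N (scheme_matrices p m c L)"
  note closed = adjacency_algebra_add[OF scheme_matrices_carrier] adjacency_algebra_diff[OF scheme_matrices_carrier]
    adjacency_algebra_smult[OF scheme_matrices_carrier]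
  have gen: "A0 p c \<gamma> \<in> ?W" "A1 p m c L \<gamma> \<in> ?W" "A2 q \<in> ?W" for \<gamma>
    using adjacency_algebra_generators[OF scheme_matrices_carrier] by (auto simp: scheme_matrices_def)
  have F: "F0 p c \<alpha> \<in> ?W" "F1 p m c L \<alpha> \<in> ?W" for \<alpha>
  proof -
    show "F0 p c \<alpha> \<in> ?W"
      unfolding F0_def character_sum_def card_q N_def[symmetric]
      by (intro adjacency_algebra_matsum[OF scheme_matrices_carrier] Pi_I closed gen)
    show "F1 p m c L \<alpha> \<in> ?W"
      unfolding F1_def character_sum_def card_q N_def[symmetric]
      by (intro adjacency_algebra_matsum[OF scheme_matrices_carrier] Pi_I closed gen)
  qed
  have "F0 p c 0 + A2 q + F1 p m c L 0 \<in> ?W"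
    by (intro closed F gen)
  then have J: "coarse 1 0 0 \<in> ?W" by (simp add: coarse_generators coarse_linear)
  have basic: "coarse 0 1 (- 1) \<in> ?W" "coarse 0 0 1 \<in> ?W"
    using F(1)[of 0] gen(3) by (simp_all only: coarse_generators)
  have coarse: "coarse a b d \<in> ?W" for a b d
  proof -
    have "coarse a b d = a \<cdot>\<^sub>m coarse 1 0 0 + b \<cdot>\<^sub>m coarse 0 1 (- 1) + (b + d) \<cdot>\<^sub>m coarse 0 0 1"
      by (simp add: coarse_linear)
    then show ?thesis by (simp only: closed J basic)
  qed
  show "E_one p m c L i \<in> ?W" if "i \<in> {0, 1, 2}"
    using that by (auto simp: E_one_coarse coarse)
  show "E_two p m c L \<alpha> j k \<in> ?W" if "j \<in> {1, 2}" "k \<in> {1, 2}"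
    using that by (elim insertE emptyE) (simp_all add: E_two_simps closed F del: One_nat_def)
qed

text \<open>\<open>E\<^sub>0\<close>, \<open>E\<^sub>1\<close>, \<open>E\<^sub>2\<close> span the coarse matrices and so give \<open>A\<^sub>2\<close>, \<open>F\<^bsub>0,0\<^esub>\<close> and \<open>F\<^bsub>0,1\<^esub>\<close>. The
  component of \<open>\<alpha> \<in> S\<close> gives \<open>F\<close> at \<open>\<alpha>\<close> and at \<open>- \<alpha>\<close>, and these exhaust the nonzero elements. Fourier
  inversion does the rest.\<close>
lemma algebra_generated_by_matrix_units:
  assumes G: "\<G> \<subseteq> carrier_mat N N"
    and one: "\<And>i. i \<in> {0, 1, 2} \<Longrightarrow> E_one p m c L i \<in> \<G>"
    and two: "\<And>\<alpha> j k. \<alpha> \<in> S \<Longrightarrow> j \<in> {1, 2} \<Longrightarrow> k \<in> {1, 2} \<Longrightarrow> E_two p m c L \<alpha> j k \<in> \<G>"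
    and S: "S \<union> uminus ` S = UNIV - {0}"
  shows "scheme_matrices p m c L \<subseteq> adjacency_algebra N \<G>"
proof -
  let ?W = "adjacency_algebra N \<G>"
  note closed = adjacency_algebra_add[OF G] adjacency_algebra_diff[OF G] adjacency_algebra_smult[OF G]
  have one': "E_one p m c L 0 \<in> ?W" "E_one p m c L (Suc 0) \<in> ?W" "E_one p m c L 2 \<in> ?W"
    using one[of 0] one[of 1] one[of 2] adjacency_algebra_generators[OF G] by auto
  have two': "E_two p m c L \<alpha> j k \<in> ?W" if "\<alpha> \<in> S" "j \<in> {1, 2}" "k \<in> {1, 2}" for \<alpha> j k
    using two[OF that] adjacency_algebra_generators[OF G] by auto
  have "r \<cdot>\<^sub>m (E_one p m c L 0 + E_one p m c L (Suc 0) + E_one p m c L 2) \<in> ?W"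
    by (intro closed one')
  then have K: "coarse 0 0 1 \<in> ?W"
    using r_nz by (simp add: E_one_coarse coarse_linear)
  have "r^2 \<cdot>\<^sub>m (E_one p m c L 0 + E_one p m c L 2) \<in> ?W"
    by (intro closed one')
  then have D: "coarse 0 1 0 \<in> ?W"
    using r_nz by (simp add: E_one_coarse coarse_linear)
  have "((r + 1) * r^2) \<cdot>\<^sub>m E_one p m c L 0 \<in> ?W"
    by (intro closed one')
  then have J: "coarse 1 0 0 \<in> ?W"
    using r_nz by (simp add: E_one_coarse coarse_linear)
  have "coarse 0 1 0 - coarse 0 0 1 \<in> ?W" "coarse 1 0 0 - coarse 0 1 0 \<in> ?W"
    by (intro closed K D J)+
  then have A2: "A2 q \<in> ?W" and F10: "F1 p m c L 0 \<in> ?W" and F00: "F0 p c 0 \<in> ?W"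
    using K by (simp_all add: coarse_generators coarse_linear)
  have scale: "A \<in> ?W" if "s \<cdot>\<^sub>m A \<in> ?W" "s \<noteq> 0" for s A
  proof -
    have "A = (1 / s) \<cdot>\<^sub>m (s \<cdot>\<^sub>m A)" using that(2) by (intro eq_matI) simp_all
    then show ?thesis using closed(3)[OF that(1), of "1 / s"] by simp
  qed
  have nz: "1 / r \<noteq> 0" "1 / r^2 \<noteq> 0" using r_nz by simp_all
  have F: "F0 p c \<alpha> \<in> ?W \<and> F1 p m c L \<alpha> \<in> ?W" for \<alpha>
  proof (cases "\<alpha> = 0")
    case True
    then show ?thesis using F00 F10 by simp
  next
    case False
    then consider "\<alpha> \<in> S" | \<beta> where "\<beta> \<in> S" "\<alpha> = - \<beta>" using S by blast
    then show ?thesis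
    proof cases
      case 1
      then have "(1 / r) \<cdot>\<^sub>m F0 p c \<alpha> \<in> ?W" "(1 / r^2) \<cdot>\<^sub>m F1 p m c L \<alpha> \<in> ?W"
        using two'[of \<alpha> 1 1] two'[of \<alpha> 1 2] by (simp_all add: E_two_simps del: One_nat_def)
      then show ?thesis
        using scale[OF _ nz(1)] scale[OF _ nz(2)] by blast
    next
      case 2
      then have "(1 / r) \<cdot>\<^sub>m F0 p c \<alpha> \<in> ?W" "(1 / r^2) \<cdot>\<^sub>m F1 p m c L \<alpha> \<in> ?W"
        using two'[of \<beta> 2 2] two'[of \<beta> 2 1] by (simp_all add: E_two_simps del: One_nat_def)
      then show ?thesis
        using scale[OF _ nz(1)] scale[OF _ nz(2)] by blast
    qed
  qed
  have "A0 p c \<gamma> \<in> ?W" "A1 p m c L \<gamma> \<in> ?W" for \<gamma>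
    unfolding A0_inversion A1_inversion
    by (intro closed adjacency_algebra_matsum[OF G] Pi_I F[THEN conjunct1] F[THEN conjunct2])+
  then show ?thesis using A2 by (auto simp: scheme_matrices_def)
qed

section \<open>The decomposition\<close>

text \<open>The diagonal units isolate each member of the family, which gives linear independence. As \<open>S\<close>
  and \<open>- S\<close> are disjoint, the components of different elements of \<open>S\<close> annihilate each other.\<close>
lemma matrix_units_decompose:
  assumes S: "S \<union> uminus ` S = UNIV - {0}" and disj: "S \<inter> uminus ` S = {}"
  shows "wedderburn_decomposition N (adjacency_algebra N (scheme_matrices p m c L))
    {0, 1, 2} (E_one p m c L) S (E_two p m c L)"
proof -
  let ?E1 = "E_one p m c L" and ?E2 = "E_two p m c L"
  define G where "G = case_sum ?E1 (\<lambda>(\<alpha>, j, k). ?E2 \<alpha> j k)"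
  define K :: "(nat + 'a \<times> nat \<times> nat) set" where "K = Inl ` {0, 1, 2} \<union> Inr ` (S \<times> {1, 2} \<times> {1, 2})"
  define X :: "nat + 'a \<times> nat \<times> nat \<Rightarrow> complex mat" where "X = case_sum ?E1 (\<lambda>(\<alpha>, j, k). ?E2 \<alpha> j j)"
  define Y :: "nat + 'a \<times> nat \<times> nat \<Rightarrow> complex mat" where "Y = case_sum ?E1 (\<lambda>(\<alpha>, j, k). ?E2 \<alpha> k k)"
  have nz: "\<alpha> \<noteq> 0" if "\<alpha> \<in> S" for \<alpha> using S that by blast
  have neg: "\<alpha> \<noteq> - \<beta>" if "\<alpha> \<in> S" "\<beta> \<in> S" for \<alpha> \<beta> using disj that by blast
  have two: "?E2 \<alpha> j k * ?E2 \<beta> j' k' = (if \<alpha> = \<beta> \<and> k = j' then ?E2 \<alpha> j k' else 0\<^sub>m N N)"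
    if "\<alpha> \<in> S" "\<beta> \<in> S" "j \<in> {1, 2}" "k \<in> {1, 2}" "j' \<in> {1, 2}" "k' \<in> {1, 2}"
    for \<alpha> \<beta> j k j' k'
    by (rule E_two_mult[OF nz nz neg]) (fact that)+
  have K_cases: P if "l \<in> K" and "\<And>i. i \<in> {0, 1, 2} \<Longrightarrow> l = Inl i \<Longrightarrow> P"
    and "\<And>\<alpha> j k. \<alpha> \<in> S \<Longrightarrow> j \<in> {1, 2} \<Longrightarrow> k \<in> {1, 2} \<Longrightarrow> l = Inr (\<alpha>, j, k) \<Longrightarrow> P" for l P
    using that unfolding K_def by blast
  have *: "G l \<in> carrier_mat N N \<and> X l \<in> carrier_mat N N \<and> Y l \<in> carrier_mat N N \<and> G l \<noteq> 0\<^sub>m N N"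
    if "l \<in> K" for l
    using that
  proof (rule K_cases)
    fix i assume "i \<in> {0, 1, 2}" "l = Inl i"
    then show ?thesis by (simp add: G_def X_def Y_def E_carrier E_one_nonzero del: insert_iff)
  next
    fix \<alpha> j k assume "j \<in> {1, 2}" "k \<in> {1, 2}" "l = Inr (\<alpha>, j, k)"
    then show ?thesis by (simp add: G_def X_def Y_def E_carrier E_two_nonzero del: insert_iff)
  qed
  have carrier: "G l \<in> carrier_mat N N" "X l \<in> carrier_mat N N" "Y l \<in> carrier_mat N N"
    and nonzero: "G l \<noteq> 0\<^sub>m N N" if "l \<in> K" for l
    using *[OF that] by simp_all
  have zero: "0\<^sub>m N N * A = 0\<^sub>m N N" "A * 0\<^sub>m N N = 0\<^sub>m N N" if "A \<in> carrier_mat N N" for A :: "complex mat"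
    using that by simp_all
  have isolate: "X l * G l' * Y l = (if l = l' then G l else 0\<^sub>m N N)" if l: "l \<in> K" "l' \<in> K" for l l'
    using l(1)
  proof (rule K_cases)
    fix i assume i: "i \<in> {0, 1, 2}" "l = Inl i"
    show ?thesis
      using l(2)
    proof (rule K_cases)
      fix i' assume "i' \<in> {0, 1, 2}" "l' = Inl i'"
      then show ?thesis
        using i by (simp add: G_def X_def Y_def E_one_mult zero E_carrier del: insert_iff)
    next
      fix \<beta> j k assume "\<beta> \<in> S" "j \<in> {1, 2}" "k \<in> {1, 2}" "l' = Inr (\<beta>, j, k)"
      then show ?thesis
        using i by (simp add: G_def X_def Y_def E_one_E_two_orthogonal nz zero E_carrier del: insert_iff)
    qed
  next
    fix \<alpha> j k assume a: "\<alpha> \<in> S" "j \<in> {1, 2}" "k \<in> {1, 2}" "l = Inr (\<alpha>, j, k)"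
    show ?thesis
      using l(2)
    proof (rule K_cases)
      fix i assume "i \<in> {0, 1, 2}" "l' = Inl i"
      then show ?thesis
        using a by (simp add: G_def X_def Y_def E_one_E_two_orthogonal nz zero E_carrier del: insert_iff)
    next
      fix \<beta> j' k' assume "\<beta> \<in> S" "j' \<in> {1, 2}" "k' \<in> {1, 2}" "l' = Inr (\<beta>, j', k')"
      then show ?thesis
        using a by (auto simp add: G_def X_def Y_def two zero E_carrier simp del: insert_iff)
    qed
  qed
  have "finite K" unfolding K_def by simp
  note indep = extractors_imp_independent[of K G N X Y, OF \<open>finite K\<close> carrier nonzero isolate]
  have sub: "G ` K \<subseteq> adjacency_algebra N (scheme_matrices p m c L)"
    using matrix_units_in_algebra unfolding K_def G_def by auto
  have gen: "scheme_matrices p m c L \<subseteq> adjacency_algebra N (G ` K)"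
  proof (rule algebra_generated_by_matrix_units[OF _ _ _ S])
    show "G ` K \<subseteq> carrier_mat N N" using carrier by blast
    show "?E1 i \<in> G ` K" if "i \<in> {0, 1, 2}" for i
      by (rule image_eqI[of _ _ "Inl i"]) (use that in \<open>auto simp: G_def K_def\<close>)
    show "?E2 \<alpha> j k \<in> G ` K" if "\<alpha> \<in> S" "j \<in> {1, 2}" "k \<in> {1, 2}" for \<alpha> j k
      by (rule image_eqI[of _ _ "Inr (\<alpha>, j, k)"]) (use that in \<open>auto simp: G_def K_def\<close>)
  qed
  have basis: "vectorspace.basis class_ring
      (vectorspace.vs (mat_space N) (adjacency_algebra N (scheme_matrices p m c L))) (G ` K)"
    by (rule basis_of_adjacency_algebra[OF scheme_matrices_carrier sub gen indep(2)])
  show ?thesis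
    unfolding wedderburn_decomposition_def Let_def G_def[symmetric] K_def[symmetric]
  proof (intro conjI ballI)
    show "inj_on G K" by (rule indep(1))
    show "vectorspace.basis class_ring
      (vectorspace.vs (mat_space N) (adjacency_algebra N (scheme_matrices p m c L))) (G ` K)"
      by (rule basis)
  qed (rule E_one_mult E_one_E_two_orthogonal E_one_adjoint E_two_adjoint two nz; assumption?)+
qed

end

theorem theorem5p5:
  fixes p m q :: nat
    and c :: "'a::{field,finite} \<Rightarrow> nat list"
    and L :: "'a option mat"
    and S :: "'a set"
  assumes "prime p" and "odd p" and "m \<ge> 1" and "q = p ^ m" and "CARD('a) = q"
    and "additive_identification p m c"
    and "symmetric_latin_square L"
    and "S \<union> uminus ` S = UNIV - {0}" and "S \<inter> uminus ` S = {}"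
  shows "wedderburn_decomposition ((q + 1) * q^2)
    (adjacency_algebra ((q + 1) * q^2) (scheme_matrices p m c L))
    {0, 1, 2} (E_one p m c L) S (E_two p m c L)"
proof -
  interpret latin_scheme p m q c L
    using assms by unfold_locales auto
  show ?thesis
    using matrix_units_decompose[OF assms(8,9)] by (simp only: N_def)
qed

end
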